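(* For $\lambda\in kG$ without constant term (the $t=0$ case), the algebra $H_\lambda$ has infinite global dimension.
   Context: Let $p$ be an odd prime, $k$ an algebraically closed field of characteristic $p$, and $G=\langle g\rangle$ the cyclic group of order $p$ generated by $g=\begin{pmatrix}1&1\\0&1\end{pmatrix}\in \mathrm{SL}(2,p)$. $G$ acts on the free algebra $k\langle x,y\rangle$ by algebra automorphisms with $g\cdot x=x$, $g\cdot y=x+y$, and $k\langle x,y\rangle\rtimes G$ is the smash product (so $gf=(g\cdot f)g$). For $\lambda\in kG$ set $H_\lambda=(k\langle x,y\rangle\rtimes G)/(xy-yx-\lambda)$. Writing $\lambda=\sum_{i=0}^{p-1}c_ig^i$, the constant term of $\lambda$ is $c_0$; the case $c_0=0$ is called the $t=0$ case. *)

theory Defs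
  imports
    "HOL-Analysis.Determinants"
    "HOL-Library.Poly_Mapping"
    "HOL-Library.Extended_Nat"
    "HOL-Computational_Algebra.Polynomial"
    "HOL-Algebra.Generated_Groups"
    "HOL-Algebra.QuotRing"
    "HOL-Algebra.Module"
begin

section \<open>Left modules and global dimension\<close>

text \<open>
  The library locale for modules requires a commutative ring of scalars. Only its record type is
  reused here; the fields \<open>mult\<close> and \<open>one\<close> of that record carry no meaning for a left module.
\<close>

locale left_module = R?: ring R + M?: abelian_group M for R (structure) and M (structure) +
  assumes smult_closed:
      "\<lbrakk>a \<in> carrier R; x \<in> carrier M\<rbrakk> \<Longrightarrow> a \<odot>\<^bsub>M\<^esub> x \<in> carrier M"
    and smult_l_distr:
      "\<lbrakk>a \<in> carrier R; b \<in> carrier R; x \<in> carrier M\<rbrakk> \<Longrightarrow>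
        (a \<oplus>\<^bsub>R\<^esub> b) \<odot>\<^bsub>M\<^esub> x = a \<odot>\<^bsub>M\<^esub> x \<oplus>\<^bsub>M\<^esub> b \<odot>\<^bsub>M\<^esub> x"
    and smult_r_distr:
      "\<lbrakk>a \<in> carrier R; x \<in> carrier M; y \<in> carrier M\<rbrakk> \<Longrightarrow>
        a \<odot>\<^bsub>M\<^esub> (x \<oplus>\<^bsub>M\<^esub> y) = a \<odot>\<^bsub>M\<^esub> x \<oplus>\<^bsub>M\<^esub> a \<odot>\<^bsub>M\<^esub> y"
    and smult_assoc:
      "\<lbrakk>a \<in> carrier R; b \<in> carrier R; x \<in> carrier M\<rbrakk> \<Longrightarrow>
        (a \<otimes>\<^bsub>R\<^esub> b) \<odot>\<^bsub>M\<^esub> x = a \<odot>\<^bsub>M\<^esub> (b \<odot>\<^bsub>M\<^esub> x)"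
    and smult_one:
      "x \<in> carrier M \<Longrightarrow> \<one>\<^bsub>R\<^esub> \<odot>\<^bsub>M\<^esub> x = x"

definition left_module_hom ::
    "('r, 's) ring_scheme \<Rightarrow> ('r, 'm, 'c) module_scheme \<Rightarrow> ('r, 'n, 'd) module_scheme \<Rightarrow> ('m \<Rightarrow> 'n) set"
  where "left_module_hom R M N =
    {f \<in> carrier M \<rightarrow> carrier N.
      (\<forall>x\<in>carrier M. \<forall>y\<in>carrier M. f (x \<oplus>\<^bsub>M\<^esub> y) = f x \<oplus>\<^bsub>N\<^esub> f y) \<and>
      (\<forall>a\<in>carrier R. \<forall>x\<in>carrier M. f (a \<odot>\<^bsub>M\<^esub> x) = a \<odot>\<^bsub>N\<^esub> f x)}"

definition free_left_module :: "('r, 's) ring_scheme \<Rightarrow> 'i set \<Rightarrow> ('r, 'i \<Rightarrow> 'r) module"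
  where "free_left_module R X =
    \<lparr>carrier = {f. (\<forall>i. f i \<in> carrier R) \<and> (\<forall>i. i \<notin> X \<longrightarrow> f i = \<zero>\<^bsub>R\<^esub>) \<and>
                 finite {i. f i \<noteq> \<zero>\<^bsub>R\<^esub>}},
     mult = undefined, one = undefined,
     zero = (\<lambda>i. \<zero>\<^bsub>R\<^esub>), add = (\<lambda>f g i. f i \<oplus>\<^bsub>R\<^esub> g i),
     smult = (\<lambda>a f i. a \<otimes>\<^bsub>R\<^esub> f i)\<rparr>"

text \<open>
  Projective means isomorphic to a direct summand of a free module, i.e. \<open>P\<close> is embedded in a free
  module by \<open>s\<close> with a retraction \<open>q\<close>. Index sets inside the element type of \<open>P\<close> suffice:
  a direct summand of any free module is one of the free module on \<open>carrier P\<close>.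
\<close>

definition projective_module :: "('r, 's) ring_scheme \<Rightarrow> ('r, 'm, 'c) module_scheme \<Rightarrow> bool"
  where "projective_module R P \<longleftrightarrow> left_module R P \<and>
    (\<exists>X :: 'm set.
       \<exists>s \<in> left_module_hom R P (free_left_module R X).
       \<exists>q \<in> left_module_hom R (free_left_module R X) P.
         \<forall>x\<in>carrier P. q (s x) = x)"

text \<open>
  An exact sequence \<open>0 \<rightarrow> P n \<rightarrow> \<dots> \<rightarrow> P 0 \<rightarrow> M \<rightarrow> 0\<close>, with augmentation \<open>d 0\<close> and differentials
  \<open>d (Suc i) : P (Suc i) \<rightarrow> P i\<close>.
\<close>

definition projective_resolution ::
    "('r, 's) ring_scheme \<Rightarrow> ('r, 'm) module \<Rightarrow> nat \<Rightarrow> (nat \<Rightarrow> ('r, 'm) module) \<Rightarrow> (nat \<Rightarrow> 'm \<Rightarrow> 'm) \<Rightarrow> bool"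
  where "projective_resolution R M n P d \<longleftrightarrow>
    (\<forall>i\<le>n. projective_module R (P i)) \<and>
    d 0 \<in> left_module_hom R (P 0) M \<and>
    (\<forall>i<n. d (Suc i) \<in> left_module_hom R (P (Suc i)) (P i)) \<and>
    d 0 ` carrier (P 0) = carrier M \<and>
    (\<forall>i<n. d (Suc i) ` carrier (P (Suc i)) =
             {x \<in> carrier (P i). d i x = (if i = 0 then \<zero>\<^bsub>M\<^esub> else \<zero>\<^bsub>P (i - 1)\<^esub>)}) \<and>
    {x \<in> carrier (P n). d n x = (if n = 0 then \<zero>\<^bsub>M\<^esub> else \<zero>\<^bsub>P (n - 1)\<^esub>)} = {\<zero>\<^bsub>P n\<^esub>}"

definition projective_dimension :: "('r, 's) ring_scheme \<Rightarrow> ('r, 'm) module \<Rightarrow> enat"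
  where "projective_dimension R M = Inf {enat n | n. \<exists>P d. projective_resolution R M n P d}"

text \<open>
  Modules have to live on some type. The universe \<open>'r + nat + 'u\<close> is infinite and at least as large
  as the ring, whatever \<open>'u\<close> is. Hence it contains a copy of every cyclic module, and every module
  on it has a resolution by free modules on it, from which one of minimal length is obtained by
  truncation. So projective dimensions computed inside it are the true ones, and by
  Auslander's theorem so is their supremum. The parameter \<open>'u\<close>, passed as \<open>TYPE('u)\<close>, makes the
  universe arbitrarily large.
\<close>

type_synonym ('r, 'u) module_universe = "'r + nat + 'u"

definition left_global_dimension :: "'u itself \<Rightarrow> ('r, 's) ring_scheme \<Rightarrow> enat"
  where "left_global_dimension U R =
    (SUP M \<in> {M :: ('r, ('r, 'u) module_universe) module. left_module R M}. projective_dimension R M)"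


section \<open>Smash products\<close>

text \<open>
  For a finite group \<open>G\<close> acting on a ring by automorphisms, the element \<open>\<Sum>\<^bsub>u\<in>G\<^esub> a\<^sub>u u\<close> is
  represented by its coefficient function \<open>a\<close>; multiplication is determined by
  \<open>(a u) (b v) = (a (u \<cdot> b)) (u v)\<close>.
\<close>

definition smash_product ::
    "('g, 'c) monoid_scheme \<Rightarrow> ('g \<Rightarrow> 'a \<Rightarrow> 'a :: ring_1) \<Rightarrow> ('g \<Rightarrow> 'a) ring"
  where "smash_product G act =
    \<lparr>carrier = {a. \<forall>h. h \<notin> carrier G \<longrightarrow> a h = 0},
     mult = (\<lambda>a b h. \<Sum>(u, v) \<in> {(u, v). u \<in> carrier G \<and> v \<in> carrier G \<and> u \<otimes>\<^bsub>G\<^esub> v = h}.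
                        a u * act u (b v)),
     one = (\<lambda>h. if h = \<one>\<^bsub>G\<^esub> then 1 else 0),
     zero = (\<lambda>h. 0),
     add = (\<lambda>a b h. a h + b h)\<rparr>"

definition group_algebra :: "('g, 'c) monoid_scheme \<Rightarrow> ('g \<Rightarrow> 'k :: field) ring"
  where "group_algebra G = smash_product G (\<lambda>u a. a)"


section \<open>The free algebra on two generators\<close>

datatype gen = X | Y

datatype word = Word (letters: "gen list")

instantiation word :: monoid_add
begin

definition zero_word :: word
  where "0 = Word []"

definition plus_word :: "word \<Rightarrow> word \<Rightarrow> word"
  where "u + v = Word (letters u @ letters v)"

instance
  by standard (simp_all add: zero_word_def plus_word_def)

end

text \<open>The monoid algebra of the free monoid on \<open>X\<close>, \<open>Y\<close>; its product is the library convolution.\<close>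

type_synonym 'k free_alg = "word \<Rightarrow>\<^sub>0 'k"

definition scalar :: "'k :: field \<Rightarrow> 'k free_alg"
  where "scalar c = Poly_Mapping.single 0 c"

definition gen_elem :: "gen \<Rightarrow> 'k :: field free_alg"
  where "gen_elem z = Poly_Mapping.single (Word [z]) 1"

text \<open>The \<open>k\<close>-algebra endomorphism of the free algebra sending each generator \<open>z\<close> to \<open>\<phi> z\<close>.\<close>

definition free_alg_subst :: "(gen \<Rightarrow> 'k :: field free_alg) \<Rightarrow> 'k free_alg \<Rightarrow> 'k free_alg"
  where "free_alg_subst \<phi> f =
    (\<Sum>w\<in>Poly_Mapping.keys f. scalar (Poly_Mapping.lookup f w) * prod_list (map \<phi> (letters w)))"

text \<open>
  The action induced by the natural representation on column vectors with \<open>x = (1, 0)\<close> and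
  \<open>y = (0, 1)\<close>: the images of \<open>x\<close> and \<open>y\<close> are read off the columns of the matrix.
\<close>

definition matrix_act :: "'k :: field ^ 2 ^ 2 \<Rightarrow> 'k free_alg \<Rightarrow> 'k free_alg"
  where "matrix_act A = free_alg_subst
    (\<lambda>z. case z of
        X \<Rightarrow> scalar (A $ 1 $ 1) * gen_elem X + scalar (A $ 2 $ 1) * gen_elem Y
      | Y \<Rightarrow> scalar (A $ 1 $ 2) * gen_elem X + scalar (A $ 2 $ 2) * gen_elem Y)"


section \<open>The algebras \<open>H\<^sub>\<lambda>\<close>\<close>

definition SL2 :: "('k :: field ^ 2 ^ 2) monoid"
  where "SL2 = \<lparr>carrier = {A. det A = 1}, mult = (**), one = mat 1\<rparr>"

definition g_mat :: "'k :: field ^ 2 ^ 2"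
  where "g_mat = vector [vector [1, 1], vector [0, 1]]"

text \<open>
  Over a field of characteristic \<open>p\<close>, the entries of the powers of \<open>g_mat\<close> lie in the prime field,
  so this is the subgroup of \<open>SL(2, p)\<close> generated by \<open>g_mat\<close>, inside \<open>SL(2, k)\<close>.
\<close>

definition G_grp :: "('k :: field ^ 2 ^ 2) monoid"
  where "G_grp = SL2\<lparr>carrier := generate SL2 {g_mat}\<rparr>"

definition smash_alg :: "('k :: field ^ 2 ^ 2 \<Rightarrow> 'k free_alg) ring"
  where "smash_alg = smash_product G_grp matrix_act"

definition free_alg_emb :: "'k :: field free_alg \<Rightarrow> 'k ^ 2 ^ 2 \<Rightarrow> 'k free_alg"
  where "free_alg_emb f = (\<lambda>h. if h = \<one>\<^bsub>G_grp\<^esub> then f else 0)"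

definition group_algebra_emb :: "('k :: field ^ 2 ^ 2 \<Rightarrow> 'k) \<Rightarrow> 'k ^ 2 ^ 2 \<Rightarrow> 'k free_alg"
  where "group_algebra_emb lam = (\<lambda>h. scalar (lam h))"

definition H_alg :: "('k :: field ^ 2 ^ 2 \<Rightarrow> 'k) \<Rightarrow> ('k ^ 2 ^ 2 \<Rightarrow> 'k free_alg) set ring"
  where "H_alg lam = smash_alg Quot genideal smash_alg
    {free_alg_emb (gen_elem X * gen_elem Y - gen_elem Y * gen_elem X)
       \<ominus>\<^bsub>smash_alg\<^esub> group_algebra_emb lam}"

end

theory Submission
  imports Defs "HOL-Library.Function_Algebras" "HOL-Number_Theory.Cong"
begin

text \<open>
  Let \<open>u = g - 1\<close> and let \<open>N\<close> be the sum of the elements of \<open>G\<close>. Multiplication by \<open>u\<close> and by \<open>N\<close> is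
  exact in both directions on \<open>H\<^sub>\<lambda>\<close>, because \<open>H\<^sub>\<lambda>\<close> is a direct summand, as a left module, of its
  polynomial representation, which is free over \<open>kG\<close>. Hence it is exact on projective modules, and
  by dimension shifting on every module with a finite projective resolution.

  The exactness fails on a left ideal. Let \<open>D\<close> be the derivation \<open>[-, y]\<close> of \<open>kG[x]\<close>, so that
  \<open>D x = \<lambda>\<close> and \<open>D g = x g\<close>. As \<open>\<lambda>\<close> has no constant term, there is \<open>F\<close> in \<open>u kG\<close> with \<open>D F = 2x\<lambda>\<close>, so
  \<open>x\<^sup>2 - F\<close> is central and \<open>H\<^sub>\<lambda>\<close> acts on \<open>kG[x]/(x\<^sup>2 - F) = kG + kG x\<close>, with \<open>y\<close> acting as \<open>-D\<close>. For
  \<open>p = 2m + 1\<close>, the pairs \<open>(a, b)\<close> with \<open>u\<^sup>m a = 0\<close> and \<open>u\<^bsup>m+1\<^esup> b = 0\<close> form a submodule that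
  \<open>N = u\<^bsup>2m\<^esup>\<close> annihilates. Let \<open>L\<close> be the left ideal of all \<open>h\<close> with \<open>h (1, 0)\<close> in that submodule. It
  contains \<open>N\<close>, which is killed by \<open>u\<close> but is not in \<open>N L\<close>, since \<open>N (1, 0) = (N, 0)\<close> is nonzero.
\<close>


section \<open>Projective resolutions\<close>

context left_module
begin

lemma smult_r_null: "a \<in> carrier R \<Longrightarrow> a \<odot>\<^bsub>M\<^esub> \<zero>\<^bsub>M\<^esub> = \<zero>\<^bsub>M\<^esub>"
proof -
  assume a: "a \<in> carrier R"
  have "a \<odot>\<^bsub>M\<^esub> \<zero>\<^bsub>M\<^esub> \<oplus>\<^bsub>M\<^esub> a \<odot>\<^bsub>M\<^esub> \<zero>\<^bsub>M\<^esub> = a \<odot>\<^bsub>M\<^esub> \<zero>\<^bsub>M\<^esub>"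
    using smult_r_distr[OF a M.zero_closed M.zero_closed] by simp
  then show ?thesis
    using smult_closed[OF a M.zero_closed] M.add.l_cancel_one by blast
qed

lemma smult_l_null: "x \<in> carrier M \<Longrightarrow> \<zero>\<^bsub>R\<^esub> \<odot>\<^bsub>M\<^esub> x = \<zero>\<^bsub>M\<^esub>"
proof -
  assume x: "x \<in> carrier M"
  have "\<zero>\<^bsub>R\<^esub> \<odot>\<^bsub>M\<^esub> x \<oplus>\<^bsub>M\<^esub> \<zero>\<^bsub>R\<^esub> \<odot>\<^bsub>M\<^esub> x = \<zero>\<^bsub>R\<^esub> \<odot>\<^bsub>M\<^esub> x"
    using smult_l_distr[OF R.zero_closed R.zero_closed x] by simp
  then show ?thesis
    using smult_closed[OF R.zero_closed x] M.add.l_cancel_one by blast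
qed

lemma smult_r_minus: "\<lbrakk>a \<in> carrier R; x \<in> carrier M\<rbrakk> \<Longrightarrow> a \<odot>\<^bsub>M\<^esub> (\<ominus>\<^bsub>M\<^esub> x) = \<ominus>\<^bsub>M\<^esub> (a \<odot>\<^bsub>M\<^esub> x)"
  using M.minus_equality[of "a \<odot>\<^bsub>M\<^esub> (\<ominus>\<^bsub>M\<^esub> x)" "a \<odot>\<^bsub>M\<^esub> x"]
  by (simp add: smult_r_distr[symmetric] M.l_neg smult_r_null smult_closed)

lemma smult_r_diff:
  "\<lbrakk>a \<in> carrier R; x \<in> carrier M; y \<in> carrier M\<rbrakk> \<Longrightarrow>
    a \<odot>\<^bsub>M\<^esub> (x \<ominus>\<^bsub>M\<^esub> y) = a \<odot>\<^bsub>M\<^esub> x \<ominus>\<^bsub>M\<^esub> a \<odot>\<^bsub>M\<^esub> y"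
  by (simp add: a_minus_def smult_r_minus smult_r_distr)

end

lemma left_module_hom_closed: "f \<in> left_module_hom R M N \<Longrightarrow> x \<in> carrier M \<Longrightarrow> f x \<in> carrier N"
  by (auto simp: left_module_hom_def)

lemma left_module_hom_add:
  "f \<in> left_module_hom R M N \<Longrightarrow> x \<in> carrier M \<Longrightarrow> y \<in> carrier M \<Longrightarrow>
    f (x \<oplus>\<^bsub>M\<^esub> y) = f x \<oplus>\<^bsub>N\<^esub> f y"
  by (auto simp: left_module_hom_def)

lemma left_module_hom_smult:
  "f \<in> left_module_hom R M N \<Longrightarrow> a \<in> carrier R \<Longrightarrow> x \<in> carrier M \<Longrightarrow>
    f (a \<odot>\<^bsub>M\<^esub> x) = a \<odot>\<^bsub>N\<^esub> f x"
  by (auto simp: left_module_hom_def)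

lemma left_module_hom_diff:
  assumes f: "f \<in> left_module_hom R M N" and "left_module R M" "left_module R N"
    and x: "x \<in> carrier M" and y: "y \<in> carrier M"
  shows "f (x \<ominus>\<^bsub>M\<^esub> y) = f x \<ominus>\<^bsub>N\<^esub> f y"
proof -
  interpret M: left_module R M by fact
  interpret N: left_module R N by fact
  have "f (x \<ominus>\<^bsub>M\<^esub> y) \<oplus>\<^bsub>N\<^esub> f y = f x"
    using left_module_hom_add[OF f, of "x \<ominus>\<^bsub>M\<^esub> y" y] x y
    by (simp add: M.M.minus_eq M.M.a_assoc M.M.l_neg)
  then show ?thesis
    using left_module_hom_closed[OF f] x y
    by (metis M.M.minus_closed N.M.add.inv_solve_right N.M.minus_eq)
qed

text \<open>The vanishing of the two Tate cohomology groups, when \<open>a = g - 1\<close> and \<open>b\<close> is the norm element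
  of a cyclic group generated by \<open>g\<close>.\<close>

definition exact_pair_on :: "('r, 'm, 'c) module_scheme \<Rightarrow> 'm set \<Rightarrow> 'r \<Rightarrow> 'r \<Rightarrow> bool"
  where "exact_pair_on M A a b \<longleftrightarrow>
    (\<forall>x\<in>A. a \<odot>\<^bsub>M\<^esub> x = \<zero>\<^bsub>M\<^esub> \<longrightarrow> (\<exists>y\<in>A. x = b \<odot>\<^bsub>M\<^esub> y)) \<and>
    (\<forall>x\<in>A. b \<odot>\<^bsub>M\<^esub> x = \<zero>\<^bsub>M\<^esub> \<longrightarrow> (\<exists>y\<in>A. x = a \<odot>\<^bsub>M\<^esub> y))"

lemma exact_pair_on_sym: "exact_pair_on M A a b \<longleftrightarrow> exact_pair_on M A b a"
  by (auto simp: exact_pair_on_def)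

text \<open>A diagram chase in place of a long exact sequence: \<open>a x\<close> lies in the kernel
  and is killed by \<open>b\<close>, so it equals \<open>a z\<close> with \<open>z\<close> in the
  kernel. Then \<open>x - z\<close> is killed by \<open>a\<close>, hence is divisible by
  \<open>b\<close> in \<open>P\<close>, and it has the same image as \<open>x\<close>.\<close>

lemma exact_pair_on_image_aux:
  assumes f: "f \<in> left_module_hom R P N" and P: "left_module R P" and N: "left_module R N"
    and a: "a \<in> carrier R" and b: "b \<in> carrier R" and ba: "b \<otimes>\<^bsub>R\<^esub> a = \<zero>\<^bsub>R\<^esub>"
    and exP: "exact_pair_on P (carrier P) a b"
    and exK: "exact_pair_on P {x \<in> carrier P. f x = \<zero>\<^bsub>N\<^esub>} a b"
    and x: "x \<in> carrier P" and ax: "a \<odot>\<^bsub>N\<^esub> f x = \<zero>\<^bsub>N\<^esub>"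
  shows "\<exists>y\<in>f ` carrier P. f x = b \<odot>\<^bsub>N\<^esub> y"
proof -
  interpret P: left_module R P by fact
  interpret N: left_module R N by fact
  let ?K = "{x \<in> carrier P. f x = \<zero>\<^bsub>N\<^esub>}"
  have fax: "a \<odot>\<^bsub>P\<^esub> x \<in> ?K"
    using ax left_module_hom_smult[OF f a x] P.smult_closed[OF a x] by simp
  moreover have "b \<odot>\<^bsub>P\<^esub> (a \<odot>\<^bsub>P\<^esub> x) = \<zero>\<^bsub>P\<^esub>"
    using P.smult_assoc[OF b a x] ba P.smult_l_null[OF x] by simp
  ultimately obtain z where z: "z \<in> carrier P" "f z = \<zero>\<^bsub>N\<^esub>" "a \<odot>\<^bsub>P\<^esub> x = a \<odot>\<^bsub>P\<^esub> z"
    using exK unfolding exact_pair_on_def by blast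
  have "a \<odot>\<^bsub>P\<^esub> (x \<ominus>\<^bsub>P\<^esub> z) = \<zero>\<^bsub>P\<^esub>"
    using z P.smult_r_diff[OF a x z(1)] P.smult_closed[OF a z(1)]
    by (simp add: P.M.minus_eq P.M.r_neg)
  then obtain w where w: "w \<in> carrier P" "x \<ominus>\<^bsub>P\<^esub> z = b \<odot>\<^bsub>P\<^esub> w"
    using exP x z(1) unfolding exact_pair_on_def by (meson P.M.minus_closed)
  have "f x = f (x \<ominus>\<^bsub>P\<^esub> z)"
    using left_module_hom_diff[OF f P N x z(1)] z(2) left_module_hom_closed[OF f x]
    by (simp add: N.M.minus_eq)
  also have "\<dots> = b \<odot>\<^bsub>N\<^esub> f w"
    using w left_module_hom_smult[OF f b] by simp
  finally show ?thesis
    using w by blast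
qed

lemma exact_pair_on_image:
  assumes "f \<in> left_module_hom R P N" "left_module R P" "left_module R N"
    and "a \<in> carrier R" "b \<in> carrier R" "b \<otimes>\<^bsub>R\<^esub> a = \<zero>\<^bsub>R\<^esub>" "a \<otimes>\<^bsub>R\<^esub> b = \<zero>\<^bsub>R\<^esub>"
    and "exact_pair_on P (carrier P) a b"
    and "exact_pair_on P {x \<in> carrier P. f x = \<zero>\<^bsub>N\<^esub>} a b"
  shows "exact_pair_on N (f ` carrier P) a b"
  using exact_pair_on_image_aux[of f R P N a b] exact_pair_on_image_aux[of f R P N b a] assms
    exact_pair_on_sym[of P _ a b]
  unfolding exact_pair_on_def[of N] by blast

text \<open>The module operations are coordinatewise, so the equation is solved in each coordinate
  separately.\<close>

lemma exact_pair_on_free: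
  assumes R: "ring R" and a: "a \<in> carrier R" and b: "b \<in> carrier R"
    and exR: "\<And>r. r \<in> carrier R \<Longrightarrow> a \<otimes>\<^bsub>R\<^esub> r = \<zero>\<^bsub>R\<^esub> \<Longrightarrow> \<exists>s\<in>carrier R. r = b \<otimes>\<^bsub>R\<^esub> s"
    and x: "x \<in> carrier (free_left_module R B)"
    and ax: "a \<odot>\<^bsub>free_left_module R B\<^esub> x = \<zero>\<^bsub>free_left_module R B\<^esub>"
  shows "\<exists>y\<in>carrier (free_left_module R B). x = b \<odot>\<^bsub>free_left_module R B\<^esub> y"
proof -
  interpret R: ring R by fact
  have xi: "x i \<in> carrier R" "i \<notin> B \<Longrightarrow> x i = \<zero>\<^bsub>R\<^esub>" and fin: "finite {i. x i \<noteq> \<zero>\<^bsub>R\<^esub>}"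
    and axi: "a \<otimes>\<^bsub>R\<^esub> x i = \<zero>\<^bsub>R\<^esub>" for i
    using x ax unfolding free_left_module_def by (auto dest: fun_cong)
  \<comment> \<open>Choosing \<open>0\<close> wherever \<open>x i\<close> is \<open>0\<close> keeps
    the chosen family finitely supported and supported in \<open>B\<close>.\<close>
  have "\<exists>s\<in>carrier R. x i = b \<otimes>\<^bsub>R\<^esub> s \<and> (x i = \<zero>\<^bsub>R\<^esub> \<longrightarrow> s = \<zero>\<^bsub>R\<^esub>)" for i
    using exR[OF xi(1) axi, of i] b by (cases "x i = \<zero>\<^bsub>R\<^esub>") auto
  then obtain y where y: "y i \<in> carrier R" "x i = b \<otimes>\<^bsub>R\<^esub> y i" "x i = \<zero>\<^bsub>R\<^esub> \<Longrightarrow> y i = \<zero>\<^bsub>R\<^esub>" for i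
    by metis
  have "finite {i. y i \<noteq> \<zero>\<^bsub>R\<^esub>}"
    by (rule finite_subset[OF _ fin]) (use y(3) in auto)
  then have "y \<in> carrier (free_left_module R B)"
    using y xi by (auto simp: free_left_module_def)
  moreover have "x = b \<odot>\<^bsub>free_left_module R B\<^esub> y"
    using y(2) by (auto simp: free_left_module_def)
  ultimately show ?thesis by blast
qed

text \<open>The equation is solved in the free module after embedding by \<open>s\<close>, and the
  solution is brought back by the retraction \<open>q\<close>.\<close>

lemma exact_pair_on_projective_aux:
  fixes P :: "('r, 'm, 'c) module_scheme"
  assumes P: "projective_module R P" and a: "a \<in> carrier R" and b: "b \<in> carrier R"
    and exR: "\<And>r. r \<in> carrier R \<Longrightarrow> a \<otimes>\<^bsub>R\<^esub> r = \<zero>\<^bsub>R\<^esub> \<Longrightarrow> \<exists>s\<in>carrier R. r = b \<otimes>\<^bsub>R\<^esub> s"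
    and x: "x \<in> carrier P" and ax: "a \<odot>\<^bsub>P\<^esub> x = \<zero>\<^bsub>P\<^esub>"
  shows "\<exists>y\<in>carrier P. x = b \<odot>\<^bsub>P\<^esub> y"
proof -
  interpret P: left_module R P
    using P by (simp add: projective_module_def)
  obtain B :: "'m set" and s q where s: "s \<in> left_module_hom R P (free_left_module R B)"
    and q: "q \<in> left_module_hom R (free_left_module R B) P"
    and qs: "\<forall>x\<in>carrier P. q (s x) = x"
    using P unfolding projective_module_def by meson
  let ?F = "free_left_module R B"
  \<comment> \<open>Homogeneity for the scalar zero suffices: in the free module such a multiple
    vanishes coordinatewise.\<close>
  have s0: "s \<zero>\<^bsub>P\<^esub> = \<zero>\<^bsub>?F\<^esub>"
  proof -
    have "s \<zero>\<^bsub>P\<^esub> \<in> carrier ?F"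
      using left_module_hom_closed[OF s] by simp
    then show ?thesis
      using left_module_hom_smult[OF s P.R.zero_closed P.M.zero_closed]
      by (auto simp: P.smult_l_null free_left_module_def)
  qed
  have "a \<odot>\<^bsub>?F\<^esub> s x = \<zero>\<^bsub>?F\<^esub>"
    using left_module_hom_smult[OF s a x] ax s0 by simp
  then obtain y where y: "y \<in> carrier ?F" "s x = b \<odot>\<^bsub>?F\<^esub> y"
    using exact_pair_on_free[OF P.R.ring_axioms a b exR left_module_hom_closed[OF s x]] by blast
  have "x = b \<odot>\<^bsub>P\<^esub> q y"
    using bspec[OF qs x] y left_module_hom_smult[OF q b y(1)] by simp
  then show ?thesis
    using left_module_hom_closed[OF q y(1)] by blast
qed

lemma exact_pair_on_projective:
  assumes "projective_module R P" "a \<in> carrier R" "b \<in> carrier R"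
    and "\<And>r. r \<in> carrier R \<Longrightarrow> a \<otimes>\<^bsub>R\<^esub> r = \<zero>\<^bsub>R\<^esub> \<Longrightarrow> \<exists>s\<in>carrier R. r = b \<otimes>\<^bsub>R\<^esub> s"
    and "\<And>r. r \<in> carrier R \<Longrightarrow> b \<otimes>\<^bsub>R\<^esub> r = \<zero>\<^bsub>R\<^esub> \<Longrightarrow> \<exists>s\<in>carrier R. r = a \<otimes>\<^bsub>R\<^esub> s"
  shows "exact_pair_on P (carrier P) a b"
  using exact_pair_on_projective_aux[of R P a b] exact_pair_on_projective_aux[of R P b a] assms
  unfolding exact_pair_on_def by blast

text \<open>Dimension shifting: from the zero kernel at the left end, exactness passes from each
  kernel to the image of the same differential, which is the next kernel, and finally to
  \<open>M\<close>.\<close>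

lemma exact_pair_on_resolution:
  assumes M: "left_module R M" and res: "projective_resolution R M n P d"
    and a: "a \<in> carrier R" and b: "b \<in> carrier R"
    and ba: "b \<otimes>\<^bsub>R\<^esub> a = \<zero>\<^bsub>R\<^esub>" and ab: "a \<otimes>\<^bsub>R\<^esub> b = \<zero>\<^bsub>R\<^esub>"
    and ex1: "\<And>r. r \<in> carrier R \<Longrightarrow> a \<otimes>\<^bsub>R\<^esub> r = \<zero>\<^bsub>R\<^esub> \<Longrightarrow> \<exists>s\<in>carrier R. r = b \<otimes>\<^bsub>R\<^esub> s"
    and ex2: "\<And>r. r \<in> carrier R \<Longrightarrow> b \<otimes>\<^bsub>R\<^esub> r = \<zero>\<^bsub>R\<^esub> \<Longrightarrow> \<exists>s\<in>carrier R. r = a \<otimes>\<^bsub>R\<^esub> s"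
  shows "exact_pair_on M (carrier M) a b"
proof -
  \<comment> \<open>\<open>T i\<close> is the target of \<open>d i\<close>, so that the augmentation
    and the differentials are treated alike.\<close>
  define T where "T i = (case i of 0 \<Rightarrow> M | Suc j \<Rightarrow> P j)" for i
  have T0: "T 0 = M" and TS: "T (Suc i) = P i" for i
    by (simp_all add: T_def)
  have proj: "projective_module R (P i)" if "i \<le> n" for i
    using res that by (simp add: projective_resolution_def)
  then have Pm: "left_module R (P i)" if "i \<le> n" for i
    using that by (simp add: projective_module_def)
  have Tm: "left_module R (T i)" if "i \<le> n" for i
    using that Pm M by (cases i) (simp_all add: T0 TS)
  have hom: "d i \<in> left_module_hom R (P i) (T i)" if "i \<le> n" for i
    using res that by (cases i) (simp_all add: T0 TS projective_resolution_def)
  have ker: "{x \<in> carrier (P i). d i x = \<zero>\<^bsub>T i\<^esub>} = d (Suc i) ` carrier (P (Suc i))"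
    if "i < n" for i
    using res that by (cases i) (auto simp: T0 TS projective_resolution_def)
  have kern: "{x \<in> carrier (P n). d n x = \<zero>\<^bsub>T n\<^esub>} = {\<zero>\<^bsub>P n\<^esub>}"
    using res by (cases n) (auto simp: T0 TS projective_resolution_def)
  have image_exact: "exact_pair_on (T i) (d i ` carrier (P i)) a b"
    if "i \<le> n" "exact_pair_on (P i) {x \<in> carrier (P i). d i x = \<zero>\<^bsub>T i\<^esub>} a b" for i
    using exact_pair_on_image[OF hom Pm Tm a b ba ab] that
      exact_pair_on_projective[OF proj a b ex1 ex2] by blast
  have "exact_pair_on (T i) (d i ` carrier (P i)) a b" if "i \<le> n" for i
    using that
  proof (induction rule: inc_induct)
    case base
    interpret Pn: left_module R "P n" using Pm by simp
    show ?case
      by (rule image_exact) (simp_all add: kern exact_pair_on_def Pn.smult_r_null a b)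
  next
    case (step i)
    then show ?case
      using image_exact[of i] by (simp add: ker TS)
  qed
  from this[of 0] show ?thesis
    using res by (simp add: T0 projective_resolution_def)
qed

text \<open>By dimension shifting \<open>M\<close> has no finite projective resolution at all, so
  its projective dimension is an infimum over the empty set.\<close>

lemma left_global_dimension_infinite:
  fixes R :: "('r, 's) ring_scheme" and M :: "('r, ('r, 'u) module_universe) module"
  assumes M: "left_module R M"
    and "a \<in> carrier R" "b \<in> carrier R" "b \<otimes>\<^bsub>R\<^esub> a = \<zero>\<^bsub>R\<^esub>" "a \<otimes>\<^bsub>R\<^esub> b = \<zero>\<^bsub>R\<^esub>"
    and "\<And>r. r \<in> carrier R \<Longrightarrow> a \<otimes>\<^bsub>R\<^esub> r = \<zero>\<^bsub>R\<^esub> \<Longrightarrow> \<exists>s\<in>carrier R. r = b \<otimes>\<^bsub>R\<^esub> s"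
    and "\<And>r. r \<in> carrier R \<Longrightarrow> b \<otimes>\<^bsub>R\<^esub> r = \<zero>\<^bsub>R\<^esub> \<Longrightarrow> \<exists>s\<in>carrier R. r = a \<otimes>\<^bsub>R\<^esub> s"
    and "\<not> exact_pair_on M (carrier M) a b"
  shows "left_global_dimension TYPE('u) R = \<infinity>"
proof -
  have "\<not> projective_resolution R M n P d" for n P d
    using exact_pair_on_resolution[OF M _ assms(2-7)] assms(8) by blast
  then have "projective_dimension R M = \<infinity>"
    unfolding projective_dimension_def by (simp add: Inf_enat_def)
  moreover have "projective_dimension R M \<le> left_global_dimension TYPE('u) R"
    unfolding left_global_dimension_def by (rule SUP_upper) (use M in auto)
  ultimately show ?thesis
    by (simp add: top_enat_def[symmetric] top_unique)
qed

text \<open>\<open>Inl\<close> puts the ideal into the first summand of the module universe; there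
  \<open>'b\<close> becomes \<open>nat + 'u\<close>.\<close>

definition left_ideal_module :: "('r, 's) ring_scheme \<Rightarrow> 'r set \<Rightarrow> ('r, 'r + 'b) module"
  where "left_ideal_module R L = \<lparr>carrier = Inl ` L, mult = undefined, one = undefined,
    zero = Inl \<zero>\<^bsub>R\<^esub>, add = (\<lambda>x y. Inl (projl x \<oplus>\<^bsub>R\<^esub> projl y)),
    smult = (\<lambda>a x. Inl (a \<otimes>\<^bsub>R\<^esub> projl x))\<rparr>"

lemma left_module_left_ideal:
  assumes "ring R" and sub: "L \<subseteq> carrier R" and zero: "\<zero>\<^bsub>R\<^esub> \<in> L"
    and add: "\<And>x y. x \<in> L \<Longrightarrow> y \<in> L \<Longrightarrow> x \<oplus>\<^bsub>R\<^esub> y \<in> L"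
    and mult: "\<And>a x. a \<in> carrier R \<Longrightarrow> x \<in> L \<Longrightarrow> a \<otimes>\<^bsub>R\<^esub> x \<in> L"
  shows "left_module R (left_ideal_module R L)"
proof -
  interpret R: ring R by fact
  have L: "x \<in> carrier R" if "x \<in> L" for x
    using that sub by blast
  have "abelian_group (left_ideal_module R L)"
  proof (rule abelian_groupI)
    fix x assume "x \<in> carrier (left_ideal_module R L)"
    then obtain r where r: "r \<in> L" "x = Inl r"
      by (auto simp: left_ideal_module_def)
    have "\<ominus>\<^bsub>R\<^esub> \<one>\<^bsub>R\<^esub> \<otimes>\<^bsub>R\<^esub> r \<in> L"
      using mult[OF _ r(1)] by simp
    then have "\<ominus>\<^bsub>R\<^esub> r \<in> L"
      using L[OF r(1)] by (simp add: R.l_minus)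
    then show "\<exists>y\<in>carrier (left_ideal_module R L).
        y \<oplus>\<^bsub>left_ideal_module R L\<^esub> x = \<zero>\<^bsub>left_ideal_module R L\<^esub>"
      using r L[OF r(1)] R.l_neg[of r]
      by (intro bexI[of _ "Inl (\<ominus>\<^bsub>R\<^esub> r)"]) (simp_all add: left_ideal_module_def)
  qed (auto simp: left_ideal_module_def zero add L R.a_assoc intro: R.a_comm)
  then show ?thesis
    by (intro left_module.intro left_module_axioms.intro)
      (auto simp: left_ideal_module_def L mult R.l_distr R.r_distr R.m_assoc R.ring_axioms)
qed

lemma left_global_dimension_infinite_left_ideal:
  fixes R :: "('r, 's) ring_scheme"
  assumes R: "ring R" "L \<subseteq> carrier R" "\<zero>\<^bsub>R\<^esub> \<in> L"
      "\<And>x y. x \<in> L \<Longrightarrow> y \<in> L \<Longrightarrow> x \<oplus>\<^bsub>R\<^esub> y \<in> L"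
      "\<And>a x. a \<in> carrier R \<Longrightarrow> x \<in> L \<Longrightarrow> a \<otimes>\<^bsub>R\<^esub> x \<in> L"
    and ab: "a \<in> carrier R" "b \<in> carrier R" "b \<otimes>\<^bsub>R\<^esub> a = \<zero>\<^bsub>R\<^esub>" "a \<otimes>\<^bsub>R\<^esub> b = \<zero>\<^bsub>R\<^esub>"
      "\<And>r. r \<in> carrier R \<Longrightarrow> a \<otimes>\<^bsub>R\<^esub> r = \<zero>\<^bsub>R\<^esub> \<Longrightarrow> \<exists>s\<in>carrier R. r = b \<otimes>\<^bsub>R\<^esub> s"
      "\<And>r. r \<in> carrier R \<Longrightarrow> b \<otimes>\<^bsub>R\<^esub> r = \<zero>\<^bsub>R\<^esub> \<Longrightarrow> \<exists>s\<in>carrier R. r = a \<otimes>\<^bsub>R\<^esub> s"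
    and x: "x \<in> L" "a \<otimes>\<^bsub>R\<^esub> x = \<zero>\<^bsub>R\<^esub>" "\<And>y. y \<in> L \<Longrightarrow> x \<noteq> b \<otimes>\<^bsub>R\<^esub> y"
  shows "left_global_dimension TYPE('u) R = \<infinity>"
proof -
  let ?M = "left_ideal_module R L :: ('r, ('r, 'u) module_universe) module"
  have "Inl x \<in> carrier ?M"
    using x(1) by (simp add: left_ideal_module_def)
  moreover have "a \<odot>\<^bsub>?M\<^esub> Inl x = \<zero>\<^bsub>?M\<^esub>"
    using x(2) by (simp add: left_ideal_module_def)
  moreover have "Inl x \<noteq> b \<odot>\<^bsub>?M\<^esub> y" if "y \<in> carrier ?M" for y
  proof -
    obtain r where "r \<in> L" "y = Inl r"
      using \<open>y \<in> carrier ?M\<close> by (auto simp: left_ideal_module_def)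
    then show ?thesis
      using x(3)[of r] by (simp add: left_ideal_module_def)
  qed
  ultimately have "\<not> exact_pair_on ?M (carrier ?M) a b"
    unfolding exact_pair_on_def by blast
  with left_module_left_ideal[OF R] ab show ?thesis
    by (rule left_global_dimension_infinite)
qed


section \<open>The free algebra\<close>

lemma poly_mapping_single_induct [case_names zero single add]:
  fixes f :: "'a \<Rightarrow>\<^sub>0 'b :: comm_monoid_add"
  assumes "P 0" and "\<And>a b. P (Poly_Mapping.single a b)" and "\<And>f g. P f \<Longrightarrow> P g \<Longrightarrow> P (f + g)"
  shows "P f"
proof (induction f rule: update_induct)
  case (update f a b)
  have "Poly_Mapping.update a b f = Poly_Mapping.single a b + f"
    using update(1) by (intro poly_mapping_eqI)
      (auto simp: lookup_update lookup_add lookup_single not_in_keys_iff_lookup_eq_zero)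
  then show ?case using assms(3)[OF assms(2) update(3)] by simp
qed (rule assms(1))

lemma scalar_commute: "scalar c * f = f * scalar c"
  by (induction f rule: poly_mapping_single_induct)
    (simp_all add: scalar_def mult_single mult.commute distrib_left distrib_right)

lemma scalar_left_commute: "f * (scalar c * g) = scalar c * (f * g)"
  by (metis mult.assoc scalar_commute)

lemma scalar_mult: "scalar (a * b) = scalar a * scalar b"
  by (simp add: scalar_def mult_single)

lemma scalar_add: "scalar (a + b) = scalar a + scalar b"
  by (simp add: scalar_def single_add)

lemma scalar_0 [simp]: "scalar 0 = 0" and scalar_1 [simp]: "scalar 1 = 1"
  by (simp_all add: scalar_def)

lemma letters_plus: "letters (u + v) = letters u @ letters v"
  and letters_0: "letters 0 = []"
  by (simp_all add: plus_word_def zero_word_def)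


text \<open>By the universal property of the free algebra, two arbitrary linear operators on a
  vector space make it a module; \<open>rep\<close> below is the resulting action. The scalar action
  is an explicit parameter, so that different actions can live on function and product
  types.\<close>

locale free_alg_rep =
  fixes sc :: "'k :: field \<Rightarrow> 'w :: ab_group_add \<Rightarrow> 'w" and opr :: "gen \<Rightarrow> 'w \<Rightarrow> 'w"
  assumes sc_plus: "sc (a + b) w = sc a w + sc b w"
    and sc_add: "sc a (v + w) = sc a v + sc a w"
    and sc_mult: "sc (a * b) w = sc a (sc b w)"
    and sc_1 [simp]: "sc 1 w = w"
    and opr_add: "opr z (v + w) = opr z v + opr z w"
    and opr_sc: "opr z (sc c w) = sc c (opr z w)"
begin

lemma sc_0 [simp]: "sc 0 w = 0"
  using sc_plus[of 0 0 w] by simp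

lemma sc_right_0 [simp]: "sc a 0 = 0"
  using sc_add[of a 0 0] by simp

lemma sc_sum: "sc a (\<Sum>i\<in>A. f i) = (\<Sum>i\<in>A. sc a (f i))"
  by (induction A rule: infinite_finite_induct) (simp_all add: sc_add)

lemma sc_diff: "sc a (v - w) = sc a v - sc a w"
  using sc_add[of a "v - w" w] by (simp add: eq_diff_eq)

lemma opr_right_0 [simp]: "opr z 0 = 0"
  using opr_add[of z 0 0] by simp

lemma opr_diff: "opr z (v - w) = opr z v - opr z w"
  using opr_add[of z "v - w" w] by (simp add: eq_diff_eq)

lemma opr_sum: "opr z (\<Sum>i\<in>A. f i) = (\<Sum>i\<in>A. opr z (f i))"
  by (induction A rule: infinite_finite_induct) (simp_all add: opr_add)

definition word_op :: "gen list \<Rightarrow> 'w \<Rightarrow> 'w"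
  where "word_op ws = foldr opr ws"

definition rep :: "'k free_alg \<Rightarrow> 'w \<Rightarrow> 'w"
  where "rep f w = (\<Sum>x\<in>Poly_Mapping.keys f. sc (Poly_Mapping.lookup f x) (word_op (letters x) w))"

lemma word_op_add: "word_op ws (v + w) = word_op ws v + word_op ws w"
  by (induction ws) (simp_all add: word_op_def opr_add)

lemma word_op_sc: "word_op ws (sc c w) = sc c (word_op ws w)"
  by (induction ws) (simp_all add: word_op_def opr_sc)

lemma word_op_append: "word_op (us @ vs) w = word_op us (word_op vs w)"
  by (simp add: word_op_def)

lemma rep_superset:
  "finite A \<Longrightarrow> Poly_Mapping.keys f \<subseteq> A \<Longrightarrow>
    rep f w = (\<Sum>x\<in>A. sc (Poly_Mapping.lookup f x) (word_op (letters x) w))"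
  unfolding rep_def by (rule sum.mono_neutral_left) (auto simp: in_keys_iff)

lemma rep_plus: "rep (f + g) w = rep f w + rep g w"
proof -
  let ?A = "Poly_Mapping.keys f \<union> Poly_Mapping.keys g"
  show ?thesis
    using rep_superset[of ?A f w] rep_superset[of ?A g w] rep_superset[of ?A "f + g" w]
    by (simp add: keys_add lookup_add sc_plus sum.distrib)
qed

lemma rep_single: "rep (Poly_Mapping.single x c) w = sc c (word_op (letters x) w)"
  by (simp add: rep_def)

lemma rep_0 [simp]: "rep 0 w = 0"
  by (simp add: rep_def)

lemma rep_uminus: "rep (- f) w = - rep f w"
  using rep_plus[of f "- f" w] by (simp add: add_eq_0_iff)

lemma rep_minus: "rep (f - g) w = rep f w - rep g w"
  using rep_plus[of f "- g" w] by (simp add: rep_uminus)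

lemma rep_sum: "rep (\<Sum>i\<in>A. f i) w = (\<Sum>i\<in>A. rep (f i) w)"
  by (induction A rule: infinite_finite_induct) (simp_all add: rep_plus)

lemma rep_scalar [simp]: "rep (scalar c) w = sc c w"
  by (simp add: scalar_def rep_single letters_0 word_op_def)

lemma rep_1 [simp]: "rep 1 w = w"
  using rep_scalar[of 1 w] by simp

lemma rep_gen_elem [simp]: "rep (gen_elem z) w = opr z w"
  by (simp add: gen_elem_def rep_single word_op_def)

lemma rep_add: "rep f (v + w) = rep f v + rep f w"
  by (simp add: rep_def word_op_add sc_add sum.distrib)

lemma rep_right_0 [simp]: "rep f 0 = 0"
  using rep_add[of f 0 0] by simp

lemma rep_right_sum: "rep f (\<Sum>i\<in>A. g i) = (\<Sum>i\<in>A. rep f (g i))"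
  by (induction A rule: infinite_finite_induct) (simp_all add: rep_add)

text \<open>Both sides are additive in \<open>f\<close> and in \<open>g\<close>, so monomials
  suffice; there multiplication concatenates words and \<open>word_op\<close> composes.\<close>

lemma rep_mult: "rep (f * g) w = rep f (rep g w)"
proof (induction f rule: poly_mapping_single_induct)
  case (single a b)
  show ?case
    by (induction g rule: poly_mapping_single_induct)
      (simp_all add: rep_single mult_single letters_plus word_op_append word_op_sc sc_mult
        distrib_left rep_plus rep_add)
qed (simp_all add: distrib_right rep_plus)

end

text \<open>A substitution is the action on the free algebra itself, with the generators acting by left
  multiplication with their images.\<close>

lemma free_alg_rep_subst:
  "free_alg_rep (\<lambda>c f. scalar c * f) (\<lambda>z f. \<phi> z * f :: 'k :: field free_alg)"
  by unfold_locales
    (simp_all add: distrib_left distrib_right scalar_add scalar_mult mult.assoc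
      scalar_left_commute[of "\<phi> _"])

text \<open>Evaluation at \<open>w = 1\<close> transfers the laws of \<open>rep\<close> to
  substitutions.\<close>

lemma free_alg_subst_eq_rep:
  "free_alg_rep.rep (\<lambda>c f. scalar c * f) (\<lambda>z f. \<phi> z * f) f w = free_alg_subst \<phi> f * w"
proof -
  interpret free_alg_rep "\<lambda>c f. scalar c * f" "\<lambda>z f. \<phi> z * f" by (rule free_alg_rep_subst)
  have "word_op ws w = prod_list (map \<phi> ws) * w" for ws
    by (induction ws) (simp_all add: word_op_def mult.assoc)
  then show ?thesis
    by (simp add: rep_def free_alg_subst_def sum_distrib_right mult.assoc)
qed

context
  fixes \<phi> :: "gen \<Rightarrow> 'k :: field free_alg"
begin

interpretation free_alg_rep "\<lambda>c f. scalar c * f" "\<lambda>z f. \<phi> z * f :: 'k free_alg" by (rule free_alg_rep_subst)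

lemma free_alg_subst_add: "free_alg_subst \<phi> (f + g) = free_alg_subst \<phi> f + free_alg_subst \<phi> g"
  using rep_plus[of f g 1] by (simp add: free_alg_subst_eq_rep)

lemma free_alg_subst_mult: "free_alg_subst \<phi> (f * g) = free_alg_subst \<phi> f * free_alg_subst \<phi> g"
  using rep_mult[of f g 1] by (simp add: free_alg_subst_eq_rep)

lemma free_alg_subst_scalar [simp]: "free_alg_subst \<phi> (scalar c) = scalar c"
  using rep_scalar[of c 1] by (simp add: free_alg_subst_eq_rep)

lemma free_alg_subst_gen_elem [simp]: "free_alg_subst \<phi> (gen_elem z) = \<phi> z"
  using rep_gen_elem[of z 1] by (simp add: free_alg_subst_eq_rep)

lemma free_alg_subst_single:
  "free_alg_subst \<phi> (Poly_Mapping.single x c) = scalar c * prod_list (map \<phi> (letters x))"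
  by (simp add: free_alg_subst_def)

lemma free_alg_subst_0 [simp]: "free_alg_subst \<phi> 0 = 0"
  by (simp add: free_alg_subst_def)

lemma free_alg_subst_1 [simp]: "free_alg_subst \<phi> 1 = 1"
  using free_alg_subst_scalar[of 1] by simp

lemma free_alg_subst_prod_list: "free_alg_subst \<phi> (prod_list fs) = prod_list (map (free_alg_subst \<phi>) fs)"
  by (induction fs) (simp_all add: free_alg_subst_mult)

end

lemma prod_list_gen_elem: "prod_list (map gen_elem ws) = Poly_Mapping.single (Word ws) 1"
  by (induction ws) (simp_all add: gen_elem_def mult_single plus_word_def flip: zero_word_def)

lemma free_alg_subst_id: "free_alg_subst gen_elem f = f"
proof (induction f rule: poly_mapping_single_induct)
  case (single a b)
  show ?case
    by (simp only: free_alg_subst_single prod_list_gen_elem scalar_def mult_single) simp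
qed (simp_all add: free_alg_subst_add)

lemma free_alg_subst_subst:
  "free_alg_subst \<phi> (free_alg_subst \<psi> f) = free_alg_subst (\<lambda>z. free_alg_subst \<phi> (\<psi> z)) f"
  by (induction f rule: poly_mapping_single_induct)
    (simp_all add: free_alg_subst_add free_alg_subst_mult free_alg_subst_single
      free_alg_subst_prod_list o_def)


section \<open>The group and its action\<close>

definition shear :: "'k :: field \<Rightarrow> 'k ^ 2 ^ 2"
  where "shear a = vector [vector [1, a], vector [0, 1]]"

lemma shear_nth [simp]:
  "shear a $ 1 $ 1 = 1" "shear a $ 1 $ 2 = a" "shear a $ 2 $ 1 = 0" "shear a $ 2 $ 2 = 1"
  by (simp_all add: shear_def)

lemma shear_mult: "shear a ** shear b = shear (a + b)"
  by (simp add: vec_eq_iff forall_2 matrix_matrix_mult_def sum_2)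

lemma shear_0: "shear 0 = mat 1"
  by (simp add: vec_eq_iff forall_2 mat_def)

lemma inj_shear: "inj shear"
  by (rule injI) (metis shear_nth(2))

lemma shear_eq_iff [simp]: "shear a = shear b \<longleftrightarrow> a = b"
  using inj_shear by (auto dest: injD)

section \<open>The prime field as index set of the group\<close>

definition prime_field :: "'k :: field set"
  where "prime_field = range of_nat"

lemma prime_field_0 [simp]: "0 \<in> prime_field" and prime_field_1 [simp]: "1 \<in> prime_field"
  and prime_field_of_nat [simp]: "of_nat n \<in> prime_field"
  unfolding prime_field_def by (metis rangeI of_nat_0, metis rangeI of_nat_1, simp)

lemma prime_field_add: "a \<in> prime_field \<Longrightarrow> b \<in> prime_field \<Longrightarrow> a + b \<in> prime_field"
  unfolding prime_field_def by (auto simp flip: of_nat_add)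

lemma prime_field_eq:
  assumes "CHAR('k :: field) > 0"
  shows "(prime_field :: 'k set) = of_nat ` {..<CHAR('k)}"
proof -
  have "(of_nat n :: 'k) \<in> of_nat ` {..<CHAR('k)}" for n
  proof (rule image_eqI)
    show "of_nat n = (of_nat (n mod CHAR('k)) :: 'k)"
      by (simp add: of_nat_eq_iff_cong_CHAR cong_def)
  qed (use assms in simp)
  then show ?thesis
    unfolding prime_field_def by blast
qed

lemma finite_prime_field: "CHAR('k :: field) > 0 \<Longrightarrow> finite (prime_field :: 'k set)"
  by (simp add: prime_field_eq)

lemma inj_on_of_nat_CHAR: "inj_on (of_nat :: nat \<Rightarrow> 'k :: field) {..<CHAR('k)}"
  by (rule inj_onI) (simp add: of_nat_eq_iff_cong_CHAR cong_def)

lemma prime_field_uminus: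
  assumes "CHAR('k :: field) > 0" and "(a :: 'k) \<in> prime_field"
  shows "- a \<in> prime_field"
proof -
  obtain n where a: "a = of_nat n" and n: "n < CHAR('k)"
    using assms(2) unfolding prime_field_eq[OF assms(1)] by blast
  have "of_nat n + of_nat (CHAR('k) - n) = (of_nat (n + (CHAR('k) - n)) :: 'k)"
    by (rule of_nat_add[symmetric])
  also have "n + (CHAR('k) - n) = CHAR('k)"
    using n by simp
  finally have "- a = of_nat (CHAR('k) - n)"
    unfolding a of_nat_CHAR by (rule minus_unique)
  then show ?thesis by simp
qed

lemma prime_field_diff:
  "CHAR('k :: field) > 0 \<Longrightarrow> (a :: 'k) \<in> prime_field \<Longrightarrow> b \<in> prime_field \<Longrightarrow> a - b \<in> prime_field"
  using prime_field_add[of a "- b"] prime_field_uminus[of b] by simp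

text \<open>Translation permutes the prime field. This is the change of variable for sums over the
  group.\<close>

lemma sum_prime_field_shift:
  assumes "CHAR('k :: field) > 0" and "(b :: 'k) \<in> prime_field"
  shows "(\<Sum>a\<in>prime_field. f (a + b)) = (\<Sum>a\<in>prime_field. f a)"
  by (rule sum.reindex_bij_witness[where i = "\<lambda>a. a - b" and j = "\<lambda>a. a + b"])
    (use assms prime_field_add prime_field_diff in auto)

text \<open>The power \<open>g^n\<close> is \<open>shear n\<close>, and inverses stay inside because
  the prime field is closed under negation. From here on the group is indexed by the prime
  field.\<close>

lemma carrier_G_grp:
  assumes "CHAR('k :: field) > 0"
  shows "carrier (G_grp :: ('k ^ 2 ^ 2) monoid) = shear ` prime_field"
proof -
  have g: "g_mat = shear (1 :: 'k)"
    by (simp add: g_mat_def shear_def)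
  \<comment> \<open>The inverse is computed from its definition by uniqueness: a left inverse of
    \<open>shear 1\<close> is recovered by multiplying with \<open>shear (- 1)\<close> on the
    right.\<close>
  have inv: "inv\<^bsub>SL2\<^esub> (shear 1) = shear (- 1 :: 'k)"
    unfolding m_inv_def SL2_def
  proof (rule the_equality)
    fix y :: "'k ^ 2 ^ 2"
    let ?S = "\<lparr>carrier = {A. det A = 1}, mult = (**), one = mat 1\<rparr> :: ('k ^ 2 ^ 2) monoid"
    assume "y \<in> carrier ?S \<and> shear 1 \<otimes>\<^bsub>?S\<^esub> y = \<one>\<^bsub>?S\<^esub> \<and> y \<otimes>\<^bsub>?S\<^esub> shear 1 = \<one>\<^bsub>?S\<^esub>"
    then have "y ** shear 1 = mat 1" by simp
    then have "(y ** shear 1) ** shear (- 1) = shear (- 1)" by simp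
    then show "y = shear (- 1)"
      by (simp add: matrix_mul_assoc[symmetric] shear_mult shear_0)
  qed (simp add: shear_mult shear_0 det_2)
  have "generate SL2 {shear 1} = shear ` (prime_field :: 'k set)"
  proof (intro equalityI subsetI)
    fix h :: "'k ^ 2 ^ 2"
    assume "h \<in> generate SL2 {shear 1}"
    then show "h \<in> shear ` prime_field"
    proof (induction rule: generate.induct)
      case one
      then show ?case by (auto simp: SL2_def shear_0[symmetric])
    next
      case (inv h)
      then show ?case using prime_field_uminus[OF assms prime_field_1] by (simp add: \<open>inv\<^bsub>SL2\<^esub> (shear 1) = _\<close>)
    next
      case (eng h1 h2)
      then show ?case by (auto simp: SL2_def shear_mult prime_field_add)
    qed auto
  next
    fix h :: "'k ^ 2 ^ 2"
    assume "h \<in> shear ` prime_field"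
    then obtain n where h: "h = shear (of_nat n)"
      by (auto simp: prime_field_def)
    have "shear (of_nat n :: 'k) \<in> generate SL2 {shear 1}"
    proof (induction n)
      case 0
      show ?case using generate.one[of SL2 "{shear (1 :: 'k)}"] by (simp add: SL2_def shear_0)
    next
      case (Suc n)
      show ?case
        using generate.eng[OF generate.incl[of "shear 1" "{shear (1 :: 'k)}" SL2] Suc]
        by (simp add: SL2_def shear_mult)
    qed
    with h show "h \<in> generate SL2 {shear 1}" by simp
  qed
  then show ?thesis by (simp add: G_grp_def g)
qed

lemma mult_G_grp [simp]: "u \<otimes>\<^bsub>G_grp\<^esub> v = u ** v" and one_G_grp: "\<one>\<^bsub>G_grp\<^esub> = shear 0"
  by (simp_all add: G_grp_def SL2_def shear_0)

section \<open>The action of the shears on the free algebra\<close>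

lemma matrix_act_add: "matrix_act A (f + g) = matrix_act A f + matrix_act A g"
  and matrix_act_mult: "matrix_act A (f * g) = matrix_act A f * matrix_act A g"
  and matrix_act_scalar [simp]: "matrix_act A (scalar c) = scalar c"
  and matrix_act_0 [simp]: "matrix_act A 0 = 0"
  and matrix_act_1 [simp]: "matrix_act A 1 = 1"
  by (simp_all add: matrix_act_def free_alg_subst_add free_alg_subst_mult)

lemma matrix_act_shear:
  "matrix_act (shear a) =
    free_alg_subst (\<lambda>z. case z of X \<Rightarrow> gen_elem X | Y \<Rightarrow> scalar a * gen_elem X + gen_elem Y)"
  unfolding matrix_act_def shear_nth by simp

lemma matrix_act_shear_X [simp]: "matrix_act (shear a) (gen_elem X) = gen_elem X"
  and matrix_act_shear_Y [simp]: "matrix_act (shear a) (gen_elem Y) = scalar a * gen_elem X + gen_elem Y"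
  by (simp_all add: matrix_act_shear)

lemma matrix_act_shear_0 [simp]: "matrix_act (shear 0) f = f"
proof -
  have "(\<lambda>z. case z of X \<Rightarrow> gen_elem X | Y \<Rightarrow> scalar 0 * gen_elem X + gen_elem Y) =
      (gen_elem :: gen \<Rightarrow> 'a free_alg)"
    by (auto split: gen.split)
  then show ?thesis by (simp only: matrix_act_shear free_alg_subst_id)
qed

text \<open>Both sides are substitutions, so comparing the images of \<open>X\<close> and
  \<open>Y\<close> is enough.\<close>

lemma matrix_act_shear_plus: "matrix_act (shear (a + b)) f = matrix_act (shear a) (matrix_act (shear b) f)"
proof -
  have "(case z of X \<Rightarrow> gen_elem X | Y \<Rightarrow> scalar (a + b) * gen_elem X + gen_elem Y) =
      matrix_act (shear a) (case z of X \<Rightarrow> gen_elem X | Y \<Rightarrow> scalar b * gen_elem X + gen_elem Y)" for z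
    by (cases z) (simp_all add: matrix_act_add matrix_act_mult scalar_add distrib_right add_ac)
  then show ?thesis
    by (simp add: matrix_act_shear free_alg_subst_subst)
qed


section \<open>Modules over the smash product\<close>

lemma smash_alg_simps:
  "carrier smash_alg = {a. \<forall>h. h \<notin> carrier G_grp \<longrightarrow> a h = 0}"
  "\<zero>\<^bsub>smash_alg\<^esub> = 0"
  "\<one>\<^bsub>smash_alg\<^esub> = (\<lambda>h. if h = shear 0 then 1 else 0)"
  "a \<oplus>\<^bsub>smash_alg\<^esub> b = a + b"
  by (simp_all add: smash_alg_def smash_product_def one_G_grp fun_eq_iff)

lemma smash_mult_def:
  "(a \<otimes>\<^bsub>smash_alg\<^esub> b) h =
    (\<Sum>(u, v) \<in> {(u, v). u \<in> carrier G_grp \<and> v \<in> carrier G_grp \<and> u ** v = h}. a u * matrix_act u (b v))"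
  by (simp add: smash_alg_def smash_product_def)

lemma sum_fun_apply: "(\<Sum>i\<in>A. f i) x = (\<Sum>i\<in>A. f i x)"
  by (induction A rule: infinite_finite_induct) simp_all

context
  assumes char_pos: "CHAR('k :: field) > 0"
begin

lemma smash_mult_shear:
  fixes a b :: "'k ^ 2 ^ 2 \<Rightarrow> 'k free_alg"
  assumes "c \<in> prime_field"
  shows "(a \<otimes>\<^bsub>smash_alg\<^esub> b) (shear c) =
    (\<Sum>e\<in>prime_field. a (shear e) * matrix_act (shear e) (b (shear (c - e))))"
proof -
  have "(a \<otimes>\<^bsub>smash_alg\<^esub> b) (shear c) =
      (\<Sum>(u, v) \<in> {(u, v). u \<in> shear ` prime_field \<and> v \<in> shear ` prime_field \<and> u ** v = shear c}.
        a u * matrix_act u (b v))"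
    by (simp add: smash_mult_def carrier_G_grp[OF char_pos])
  \<comment> \<open>The first factor of a pair determines the second, and its parameter is read off
    as its upper right entry.\<close>
  also have "\<dots> = (\<Sum>e\<in>prime_field. a (shear e) * matrix_act (shear e) (b (shear (c - e))))"
    by (rule sum.reindex_bij_witness[where i = "\<lambda>e. (shear e, shear (c - e))" and j = "\<lambda>(u, v). u $ 1 $ 2"])
      (auto simp: shear_mult assms prime_field_diff[OF char_pos])
  finally show ?thesis .
qed

lemma shear_mult_in_G_iff:
  assumes "(e :: 'k) \<in> prime_field"
  shows "shear e ** h \<in> carrier G_grp \<longleftrightarrow> h \<in> carrier G_grp"
proof
  assume "shear e ** h \<in> carrier G_grp"
  then obtain d where d: "d \<in> prime_field" "shear e ** h = shear d"
    by (auto simp: carrier_G_grp[OF char_pos])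
  have "h = shear (- e) ** (shear e ** h)"
    by (simp add: matrix_mul_assoc shear_mult shear_0)
  also have "\<dots> = shear (d - e)"
    by (simp add: d shear_mult)
  finally show "h \<in> carrier G_grp"
    using d assms by (simp add: carrier_G_grp[OF char_pos] prime_field_diff[OF char_pos])
qed (use assms in \<open>auto simp: carrier_G_grp[OF char_pos] shear_mult prime_field_add\<close>)

text \<open>The formula extends to every matrix \<open>h\<close>, since outside the group both sides
  vanish. In this form left multiplication can be compared with an action on all functions.\<close>

lemma smash_mult_eq:
  fixes a b :: "'k ^ 2 ^ 2 \<Rightarrow> 'k free_alg"
  assumes "b \<in> carrier smash_alg"
  shows "(a \<otimes>\<^bsub>smash_alg\<^esub> b) h =
    (\<Sum>e\<in>prime_field. a (shear e) * matrix_act (shear e) (b (shear (- e) ** h)))"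
proof (cases "h \<in> carrier G_grp")
  case True
  then obtain c where "c \<in> prime_field" "h = shear c"
    by (auto simp: carrier_G_grp[OF char_pos])
  then show ?thesis
    using smash_mult_shear[of c a b] by (simp add: shear_mult)
next
  case False
  then have "{(u, v). u \<in> carrier G_grp \<and> v \<in> carrier G_grp \<and> u ** v = h} = {}"
    using shear_mult_in_G_iff by (auto simp: carrier_G_grp[OF char_pos] shear_mult prime_field_add)
  then have "(a \<otimes>\<^bsub>smash_alg\<^esub> b) h = 0"
    by (simp only: smash_mult_def sum.empty)
  moreover have "b (shear (- e) ** h) = 0" if "e \<in> prime_field" for e
    using assms False shear_mult_in_G_iff[OF prime_field_uminus[OF char_pos that]]
    by (simp add: smash_alg_simps)
  ultimately show ?thesis by simp
qed

lemma smash_mult_closed: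
  fixes a b :: "'k ^ 2 ^ 2 \<Rightarrow> 'k free_alg"
  assumes "b \<in> carrier smash_alg"
  shows "a \<otimes>\<^bsub>smash_alg\<^esub> b \<in> carrier smash_alg"
proof -
  have "(a \<otimes>\<^bsub>smash_alg\<^esub> b) h = 0" if "h \<notin> carrier G_grp" for h
  proof -
    have "b (shear (- e) ** h) = 0" if "e \<in> prime_field" for e
      using assms \<open>h \<notin> _\<close> shear_mult_in_G_iff[OF prime_field_uminus[OF char_pos that]]
      by (simp add: smash_alg_simps)
    then show ?thesis by (simp add: smash_mult_eq[OF assms])
  qed
  then show ?thesis by (simp add: smash_alg_simps)
qed

end

definition group_elem :: "'k :: field \<Rightarrow> 'k ^ 2 ^ 2 \<Rightarrow> 'k free_alg"
  where "group_elem c = (\<lambda>h. if h = shear c then 1 else 0)"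

text \<open>\<open>tr a\<close> is the action of \<open>shear a\<close>, and \<open>tr_X\<close>,
  \<open>tr_Y\<close> are the rule \<open>g f = (g . f) g\<close> on the generators. Indexing
  \<open>tr\<close> by the whole field spares its laws the side condition
  \<open>a \<in> prime_field\<close>.\<close>

locale smash_rep = free_alg_rep sc opr
  for sc :: "'k :: field \<Rightarrow> 'w :: ab_group_add \<Rightarrow> 'w" and opr :: "gen \<Rightarrow> 'w \<Rightarrow> 'w" +
  fixes tr :: "'k \<Rightarrow> 'w \<Rightarrow> 'w"
  assumes char_pos: "CHAR('k) > 0"
    and tr_add: "tr a (v + w) = tr a v + tr a w"
    and tr_sc: "tr a (sc c w) = sc c (tr a w)"
    and tr_0 [simp]: "tr 0 w = w"
    and tr_plus: "tr (a + b) w = tr a (tr b w)"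
    and tr_X: "tr a (opr X w) = opr X (tr a w)"
    and tr_Y: "tr a (opr Y w) = sc a (opr X (tr a w)) + opr Y (tr a w)"
begin

definition act :: "('k ^ 2 ^ 2 \<Rightarrow> 'k free_alg) \<Rightarrow> 'w \<Rightarrow> 'w"
  where "act a w = (\<Sum>c\<in>prime_field. rep (a (shear c)) (tr c w))"

lemma tr_right_0 [simp]: "tr a 0 = 0"
  using tr_add[of a 0 0] by simp

lemma tr_uminus: "tr a (- v) = - tr a v"
  using tr_add[of a v "- v"] by (simp add: add_eq_0_iff)

lemma tr_diff: "tr a (v - w) = tr a v - tr a w"
  using tr_add[of a v "- w"] by (simp add: tr_uminus)

lemma tr_sum: "tr a (\<Sum>i\<in>A. f i) = (\<Sum>i\<in>A. tr a (f i))"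
  by (induction A rule: infinite_finite_induct) (simp_all add: tr_add)

text \<open>The commutation rule on generators extends to words by induction and to all elements by
  additivity.\<close>

lemma tr_rep: "tr a (rep f w) = rep (matrix_act (shear a) f) (tr a w)"
proof (induction f rule: poly_mapping_single_induct)
  case (single x c)
  let ?\<phi> = "\<lambda>z. case z of X \<Rightarrow> gen_elem X | Y \<Rightarrow> scalar a * gen_elem X + gen_elem Y"
  have gen: "tr a (opr z v) = rep (?\<phi> z) (tr a v)" for z v
    by (cases z) (simp_all add: tr_X tr_Y rep_plus rep_mult)
  have "tr a (word_op ws w) = rep (prod_list (map ?\<phi> ws)) (tr a w)" for ws
    by (induction ws) (simp_all add: word_op_def gen rep_mult)
  then show ?case
    by (simp add: matrix_act_shear free_alg_subst_single rep_single rep_mult tr_sc)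
qed (simp_all add: matrix_act_add rep_plus tr_add)

lemma act_plus: "act (a + b) w = act a w + act b w"
  by (simp add: act_def rep_plus sum.distrib)

lemma act_0 [simp]: "act 0 w = 0"
  by (simp add: act_def)

lemma act_uminus: "act (- a) w = - act a w"
  using act_plus[of a "- a" w] by (simp add: add_eq_0_iff)

lemma act_minus: "act (a - b) w = act a w - act b w"
  using act_plus[of a "- b" w] by (simp add: act_uminus)

lemma act_add: "act a (v + w) = act a v + act a w"
  by (simp add: act_def rep_add tr_add sum.distrib)

lemma act_right_0 [simp]: "act a 0 = 0"
  using act_add[of a 0 0] by simp

lemma act_mult: "act (a \<otimes>\<^bsub>smash_alg\<^esub> b) w = act a (act b w)"
proof -
  let ?F = "prime_field :: 'k set"
  have "act (a \<otimes>\<^bsub>smash_alg\<^esub> b) w =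
      (\<Sum>c\<in>?F. \<Sum>e\<in>?F. rep (a (shear e)) (rep (matrix_act (shear e) (b (shear (c - e)))) (tr c w)))"
    unfolding act_def
    by (rule sum.cong) (simp_all add: smash_mult_shear[OF char_pos] rep_sum rep_mult)
  also have "\<dots> = (\<Sum>e\<in>?F. \<Sum>c\<in>?F. rep (a (shear e)) (rep (matrix_act (shear e) (b (shear (c - e)))) (tr c w)))"
    by (rule sum.swap)
  \<comment> \<open>The substitution \<open>c = d + e\<close> turns the convolution into a double
    sum over independent indices.\<close>
  also have "\<dots> = (\<Sum>e\<in>?F. \<Sum>d\<in>?F. rep (a (shear e)) (rep (matrix_act (shear e) (b (shear d))) (tr (d + e) w)))"
  proof (rule sum.cong)
    fix e :: 'k assume "e \<in> ?F"
    from sum_prime_field_shift[OF char_pos this,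
        of "\<lambda>c. rep (a (shear e)) (rep (matrix_act (shear e) (b (shear (c - e)))) (tr c w))"]
    show "(\<Sum>c\<in>?F. rep (a (shear e)) (rep (matrix_act (shear e) (b (shear (c - e)))) (tr c w))) =
        (\<Sum>d\<in>?F. rep (a (shear e)) (rep (matrix_act (shear e) (b (shear d))) (tr (d + e) w)))"
      by simp
  qed simp
  also have "\<dots> = act a (act b w)"
    by (simp add: act_def tr_sum tr_rep rep_right_sum tr_plus[symmetric] add.commute)
  finally show ?thesis .
qed

lemma act_single:
  assumes "c \<in> prime_field"
  shows "act (\<lambda>h. if h = shear c then f else 0) w = rep f (tr c w)"
proof -
  have "act (\<lambda>h. if h = shear c then f else 0) w =
      (\<Sum>e\<in>prime_field. if e = c then rep f (tr e w) else 0)"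
    unfolding act_def by (rule sum.cong) auto
  then show ?thesis
    using assms by (simp add: finite_prime_field[OF char_pos])
qed

lemma act_group_elem: "c \<in> prime_field \<Longrightarrow> act (group_elem c) w = tr c w"
  using act_single[of c 1 w] by (simp add: group_elem_def)

lemma act_free_alg_emb: "act (free_alg_emb f) w = rep f w"
  using act_single[OF prime_field_0, of f w] by (simp add: free_alg_emb_def one_G_grp)

lemma act_one: "act \<one>\<^bsub>smash_alg\<^esub> w = w"
  using act_single[OF prime_field_0, of 1 w] by (simp add: smash_alg_simps)

lemma act_group_algebra_emb:
  "act (group_algebra_emb l) w = (\<Sum>c\<in>prime_field. sc (l (shear c)) (tr c w))"
  by (simp add: act_def group_algebra_emb_def)

end


section \<open>The smash product as a module over itself\<close>

definition reg_sc :: "'k :: field \<Rightarrow> ('k ^ 2 ^ 2 \<Rightarrow> 'k free_alg) \<Rightarrow> 'k ^ 2 ^ 2 \<Rightarrow> 'k free_alg"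
  where "reg_sc c s h = scalar c * s h"

definition reg_opr :: "gen \<Rightarrow> ('k :: field ^ 2 ^ 2 \<Rightarrow> 'k free_alg) \<Rightarrow> 'k ^ 2 ^ 2 \<Rightarrow> 'k free_alg"
  where "reg_opr z s h = gen_elem z * s h"

text \<open>Left multiplication by the group element \<open>shear a\<close>: its inverse shifts the
  index, and its action is applied to the coefficient it passes.\<close>

definition reg_tr :: "'k :: field \<Rightarrow> ('k ^ 2 ^ 2 \<Rightarrow> 'k free_alg) \<Rightarrow> 'k ^ 2 ^ 2 \<Rightarrow> 'k free_alg"
  where "reg_tr a s h = matrix_act (shear a) (s (shear (- a) ** h))"

lemma matrix_act_mat_1: "matrix_act (mat 1) f = f"
  unfolding shear_0[symmetric] by simp

text \<open>The representation space is the full function type, which is an additive group as a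
  type, rather than the carrier. On the carrier its action will be left multiplication.\<close>

lemma smash_rep_regular:
  assumes "CHAR('k :: field) > 0"
  shows "smash_rep (reg_sc :: 'k \<Rightarrow> _) reg_opr reg_tr"
proof
  show "reg_tr (a + b) w = reg_tr a (reg_tr b w)" for a b :: 'k and w
  proof
    fix h :: "'k ^ 2 ^ 2"
    have "shear (- (a + b)) ** h = shear (- b) ** (shear (- a) ** h)"
      by (simp add: matrix_mul_assoc shear_mult minus_diff_commute)
    then show "reg_tr (a + b) w h = reg_tr a (reg_tr b w) h"
      by (simp add: reg_tr_def matrix_act_shear_plus)
  qed
qed (simp_all add: fun_eq_iff reg_sc_def reg_opr_def reg_tr_def assms distrib_left distrib_right
    scalar_add scalar_mult mult.assoc scalar_left_commute[of "gen_elem _"]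
    matrix_act_add matrix_act_mult shear_0 matrix_act_mat_1)

context
  assumes char_pos: "CHAR('k :: field) > 0"
begin

interpretation reg: smash_rep "reg_sc :: 'k \<Rightarrow> _" reg_opr reg_tr
  by (rule smash_rep_regular[OF char_pos])

lemma rep_regular: "reg.rep f s = (\<lambda>h. f * s h)"
proof (induction f rule: poly_mapping_single_induct)
  case (single x c)
  have "reg.word_op ws s h = Poly_Mapping.single (Word ws) 1 * s h" for ws h
  proof (induction ws)
    case (Cons z ws)
    have "reg.word_op (z # ws) s h = gen_elem z * reg.word_op ws s h"
      unfolding reg.word_op_def by (simp add: reg_opr_def)
    also have "\<dots> = gen_elem z * Poly_Mapping.single (Word ws) 1 * s h"
      by (simp add: Cons mult.assoc)
    finally show ?case
      by (simp add: prod_list_gen_elem[symmetric])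
  qed (simp add: reg.word_op_def flip: zero_word_def)
  then show ?case
    unfolding reg.rep_single by (simp add: fun_eq_iff reg_sc_def scalar_def mult.assoc[symmetric] mult_single)
qed (simp_all add: reg.rep_plus distrib_right fun_eq_iff)

lemma act_regular:
  assumes "b \<in> carrier smash_alg"
  shows "reg.act a b = a \<otimes>\<^bsub>smash_alg\<^esub> b"
proof
  fix h :: "'k ^ 2 ^ 2"
  show "reg.act a b h = (a \<otimes>\<^bsub>smash_alg\<^esub> b) h"
    unfolding smash_mult_eq[OF char_pos assms] reg.act_def sum_fun_apply rep_regular reg_tr_def ..
qed

text \<open>Besides giving the right unit law, this recovers an element from its action on the
  unit.\<close>

lemma act_regular_one:
  assumes "a \<in> carrier smash_alg"
  shows "reg.act a \<one>\<^bsub>smash_alg\<^esub> = a"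
proof
  fix h :: "'k ^ 2 ^ 2"
  have "shear (- e) ** h = shear 0 \<longleftrightarrow> h = shear e" for e
  proof
    assume "shear (- e) ** h = shear 0"
    then have "shear e ** (shear (- e) ** h) = shear e ** shear 0" by simp
    then show "h = shear e"
      by (simp add: matrix_mul_assoc shear_mult shear_0)
  qed (simp add: shear_mult)
  then have "reg.act a \<one>\<^bsub>smash_alg\<^esub> h =
      (\<Sum>e\<in>prime_field. a (shear e) * (if h = shear e then 1 else 0))"
    unfolding reg.act_def sum_fun_apply rep_regular reg_tr_def smash_alg_simps
    by (intro sum.cong) simp_all
  also have "\<dots> = a h"
  proof (cases "h \<in> carrier G_grp")
    case True
    then obtain c where "c \<in> prime_field" "h = shear c"
      by (auto simp: carrier_G_grp[OF char_pos])
    then show ?thesis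
      by (simp add: if_distrib finite_prime_field[OF char_pos] cong: if_cong)
  next
    case False
    then have "h \<noteq> shear e" if "e \<in> prime_field" for e
      using that by (auto simp: carrier_G_grp[OF char_pos])
    then show ?thesis
      using assms False by (simp add: smash_alg_simps)
  qed
  finally show "reg.act a \<one>\<^bsub>smash_alg\<^esub> h = a h" .
qed

text \<open>Associativity and distributivity are \<open>act_mult\<close>, \<open>act_plus\<close>
  and \<open>act_add\<close> read in the regular representation.\<close>

lemma ring_smash_alg: "ring (smash_alg :: ('k ^ 2 ^ 2 \<Rightarrow> 'k free_alg) ring)"
proof (rule ringI)
  let ?S = "smash_alg :: ('k ^ 2 ^ 2 \<Rightarrow> 'k free_alg) ring"
  show "abelian_group ?S"
  proof (rule abelian_groupI)
    fix x assume "x \<in> carrier ?S"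
    then show "\<exists>y\<in>carrier ?S. y \<oplus>\<^bsub>?S\<^esub> x = \<zero>\<^bsub>?S\<^esub>"
      by (intro bexI[of _ "- x"]) (simp_all add: smash_alg_simps)
  qed (auto simp: smash_alg_simps add_ac)
  have one: "\<one>\<^bsub>?S\<^esub> \<in> carrier ?S"
    by (auto simp: smash_alg_simps carrier_G_grp[OF char_pos])
  show "monoid ?S"
  proof (rule monoidI)
    show "x \<otimes>\<^bsub>?S\<^esub> y \<otimes>\<^bsub>?S\<^esub> z = x \<otimes>\<^bsub>?S\<^esub> (y \<otimes>\<^bsub>?S\<^esub> z)"
      if "x \<in> carrier ?S" "y \<in> carrier ?S" "z \<in> carrier ?S" for x y z
      using reg.act_mult[of x y z] that by (simp add: act_regular smash_mult_closed[OF char_pos])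
    show "\<one>\<^bsub>?S\<^esub> \<otimes>\<^bsub>?S\<^esub> x = x" if "x \<in> carrier ?S" for x
      using reg.act_one[of x] that by (simp add: act_regular)
    show "x \<otimes>\<^bsub>?S\<^esub> \<one>\<^bsub>?S\<^esub> = x" if "x \<in> carrier ?S" for x
      using act_regular_one[OF that] one by (simp add: act_regular)
  qed (auto simp: one smash_mult_closed[OF char_pos])
  fix x y z assume xyz: "x \<in> carrier ?S" "y \<in> carrier ?S" "z \<in> carrier ?S"
  show "(x \<oplus>\<^bsub>?S\<^esub> y) \<otimes>\<^bsub>?S\<^esub> z = x \<otimes>\<^bsub>?S\<^esub> z \<oplus>\<^bsub>?S\<^esub> y \<otimes>\<^bsub>?S\<^esub> z"
    using reg.act_plus[of x y z] xyz by (simp add: act_regular smash_alg_simps)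
  have "x + y \<in> carrier ?S"
    using xyz by (simp add: smash_alg_simps)
  then show "z \<otimes>\<^bsub>?S\<^esub> (x \<oplus>\<^bsub>?S\<^esub> y) = z \<otimes>\<^bsub>?S\<^esub> x \<oplus>\<^bsub>?S\<^esub> z \<otimes>\<^bsub>?S\<^esub> y"
    using reg.act_add[of z x y] xyz act_regular[OF \<open>x + y \<in> _\<close>] by (simp add: act_regular smash_alg_simps)
qed

end


section \<open>Modules over \<open>H\<^sub>\<lambda>\<close>\<close>

locale H_param =
  fixes lam :: "'k :: field ^ 2 ^ 2 \<Rightarrow> 'k"
  assumes char_pos: "CHAR('k) > 0"
    and lam_carrier: "lam \<in> carrier (group_algebra G_grp)"
begin

section \<open>The relation ideal and calculations modulo it\<close>

definition rel_elem :: "'k ^ 2 ^ 2 \<Rightarrow> 'k free_alg"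
  where "rel_elem = free_alg_emb (gen_elem X * gen_elem Y - gen_elem Y * gen_elem X)
    \<ominus>\<^bsub>smash_alg\<^esub> group_algebra_emb lam"

definition rel_ideal :: "('k ^ 2 ^ 2 \<Rightarrow> 'k free_alg) set"
  where "rel_ideal = genideal smash_alg {rel_elem}"

lemma H_alg_eq: "H_alg lam = smash_alg Quot rel_ideal"
  by (simp add: H_alg_def rel_ideal_def rel_elem_def)

sublocale S: ring "smash_alg :: ('k ^ 2 ^ 2 \<Rightarrow> 'k free_alg) ring"
  by (rule ring_smash_alg[OF char_pos])

lemma smash_a_inv: "a \<in> carrier smash_alg \<Longrightarrow> \<ominus>\<^bsub>smash_alg\<^esub> a = (- a :: 'k ^ 2 ^ 2 \<Rightarrow> 'k free_alg)"
  by (rule S.minus_equality) (simp_all add: smash_alg_simps)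

lemma smash_a_minus:
  "b \<in> carrier smash_alg \<Longrightarrow> a \<ominus>\<^bsub>smash_alg\<^esub> b = (a - b :: 'k ^ 2 ^ 2 \<Rightarrow> 'k free_alg)"
  by (simp add: a_minus_def smash_a_inv smash_alg_simps)

lemma smash_closed:
  "free_alg_emb f \<in> carrier (smash_alg :: ('k ^ 2 ^ 2 \<Rightarrow> 'k free_alg) ring)"
  "group_algebra_emb lam \<in> carrier smash_alg"
  "c \<in> prime_field \<Longrightarrow> group_elem c \<in> carrier (smash_alg :: ('k ^ 2 ^ 2 \<Rightarrow> 'k free_alg) ring)"
proof -
  have "\<one>\<^bsub>G_grp\<^esub> \<in> carrier (G_grp :: ('k ^ 2 ^ 2) monoid)"
    by (simp add: carrier_G_grp[OF char_pos] one_G_grp)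
  then show "free_alg_emb f \<in> carrier (smash_alg :: ('k ^ 2 ^ 2 \<Rightarrow> 'k free_alg) ring)"
    by (auto simp: smash_alg_simps free_alg_emb_def)
  show "group_algebra_emb lam \<in> carrier smash_alg"
    using lam_carrier by (simp add: smash_alg_simps group_algebra_emb_def group_algebra_def smash_product_def)
  show "c \<in> prime_field \<Longrightarrow> group_elem c \<in> carrier (smash_alg :: ('k ^ 2 ^ 2 \<Rightarrow> 'k free_alg) ring)"
    by (auto simp: smash_alg_simps group_elem_def carrier_G_grp[OF char_pos])
qed

lemma smash_diff_closed:
  "a \<in> carrier smash_alg \<Longrightarrow> b \<in> carrier smash_alg \<Longrightarrow> (a - b :: 'k ^ 2 ^ 2 \<Rightarrow> 'k free_alg) \<in> carrier smash_alg"
  by (simp add: smash_alg_simps)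

lemma smash_sum_closed:
  "(\<And>i. i \<in> A \<Longrightarrow> f i \<in> carrier smash_alg) \<Longrightarrow> (\<Sum>i\<in>A. f i :: 'k ^ 2 ^ 2 \<Rightarrow> 'k free_alg) \<in> carrier smash_alg"
  by (auto simp: smash_alg_simps sum_fun_apply)

lemma rel_elem_closed: "rel_elem \<in> carrier smash_alg"
  unfolding rel_elem_def using smash_closed by blast

lemma ideal_rel_ideal: "ideal rel_ideal smash_alg"
  unfolding rel_ideal_def by (rule S.genideal_ideal) (simp add: rel_elem_closed)

sublocale J: ideal rel_ideal smash_alg
  by (rule ideal_rel_ideal)

lemma rel_ideal_0: "0 \<in> rel_ideal"
  using J.zero_closed by (simp add: smash_alg_simps)

lemma rel_ideal_add: "a \<in> rel_ideal \<Longrightarrow> b \<in> rel_ideal \<Longrightarrow> a + b \<in> rel_ideal"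
  using J.a_closed[of a b] by (simp add: smash_alg_simps)

lemma rel_ideal_uminus: "a \<in> rel_ideal \<Longrightarrow> - a \<in> rel_ideal"
  using J.a_inv_closed[of a] J.a_Hcarr[of a] by (simp add: smash_a_inv)

lemma rel_ideal_diff: "a \<in> rel_ideal \<Longrightarrow> b \<in> rel_ideal \<Longrightarrow> a - b \<in> rel_ideal"
  using rel_ideal_add[of a "- b"] rel_ideal_uminus[of b] by simp

lemma rel_ideal_sum: "(\<And>i. i \<in> A \<Longrightarrow> f i \<in> rel_ideal) \<Longrightarrow> (\<Sum>i\<in>A. f i) \<in> rel_ideal"
  by (induction A rule: infinite_finite_induct) (auto simp: rel_ideal_0 intro: rel_ideal_add)

sublocale reg: smash_rep "reg_sc :: 'k \<Rightarrow> _" reg_opr reg_tr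
  by (rule smash_rep_regular[OF char_pos])

lemma reg_closed:
  fixes s :: "'k ^ 2 ^ 2 \<Rightarrow> 'k free_alg"
  assumes "s \<in> carrier smash_alg"
  shows "reg_sc c s \<in> carrier smash_alg" "reg_opr z s \<in> carrier smash_alg"
    "a \<in> prime_field \<Longrightarrow> reg_tr a s \<in> carrier smash_alg"
proof -
  have "reg.act (free_alg_emb f) s \<in> carrier smash_alg" for f
    using act_regular[OF char_pos assms] smash_closed(1) assms by simp
  from this[of "scalar c"] this[of "gen_elem z"]
  show "reg_sc c s \<in> carrier smash_alg" "reg_opr z s \<in> carrier smash_alg"
    by (simp_all add: reg.act_free_alg_emb)
  assume "a \<in> prime_field"
  then show "reg_tr a s \<in> carrier smash_alg"
    using act_regular[OF char_pos assms, of "group_elem a"] smash_closed(3)[of a] assms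
    by (simp add: reg.act_group_elem)
qed

lemma rel_ideal_reg:
  assumes "j \<in> rel_ideal"
  shows "reg_sc c j \<in> rel_ideal" "reg_opr z j \<in> rel_ideal"
    "a \<in> prime_field \<Longrightarrow> reg_tr a j \<in> rel_ideal"
proof -
  note j = J.a_Hcarr[OF assms]
  have "reg.act (free_alg_emb f) j \<in> rel_ideal" for f
    using act_regular[OF char_pos j] smash_closed(1) J.I_l_closed[OF assms] by simp
  from this[of "scalar c"] this[of "gen_elem z"]
  show "reg_sc c j \<in> rel_ideal" "reg_opr z j \<in> rel_ideal"
    by (simp_all add: reg.act_free_alg_emb)
  assume "a \<in> prime_field"
  then show "reg_tr a j \<in> rel_ideal"
    using act_regular[OF char_pos j, of "group_elem a"] smash_closed(3)[of a] J.I_l_closed[OF assms]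
    by (simp add: reg.act_group_elem)
qed

text \<open>Left multiplication by \<open>lam\<close>, expressed through the operators of the
  regular representation.\<close>

definition reg_lam :: "('k ^ 2 ^ 2 \<Rightarrow> 'k free_alg) \<Rightarrow> 'k ^ 2 ^ 2 \<Rightarrow> 'k free_alg"
  where "reg_lam s = (\<Sum>c\<in>prime_field. reg_sc (lam (shear c)) (reg_tr c s))"

text \<open>This is the product of \<open>rel_elem\<close> with \<open>s\<close>, expanded.\<close>

lemma rel_ideal_commutator:
  fixes s :: "'k ^ 2 ^ 2 \<Rightarrow> 'k free_alg"
  assumes "s \<in> carrier smash_alg"
  shows "reg_opr X (reg_opr Y s) - reg_opr Y (reg_opr X s) - reg_lam s \<in> rel_ideal"
proof -
  have "rel_elem \<otimes>\<^bsub>smash_alg\<^esub> s \<in> rel_ideal"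
    using J.I_r_closed[OF _ assms] S.genideal_self'[OF rel_elem_closed] by (simp add: rel_ideal_def)
  then have "reg.act rel_elem s \<in> rel_ideal"
    by (simp add: act_regular[OF char_pos assms])
  then show ?thesis
    unfolding rel_elem_def smash_a_minus[OF smash_closed(2)]
    by (simp add: reg.act_minus reg.act_free_alg_emb reg.act_group_algebra_emb reg.rep_minus
        reg.rep_mult reg_lam_def)
qed

end

locale H_rep = smash_rep sc opr tr + H_param lam
  for sc :: "'k :: field \<Rightarrow> 'w :: ab_group_add \<Rightarrow> 'w" and opr tr
    and lam :: "'k ^ 2 ^ 2 \<Rightarrow> 'k" +
  assumes commutator:
    "opr X (opr Y w) - opr Y (opr X w) = (\<Sum>c\<in>prime_field. sc (lam (shear c)) (tr c w))"
begin

text \<open>The annihilator of the representation is a two-sided ideal containing the defining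
  relation, hence contains the ideal generated by it. So the action descends to the
  quotient.\<close>

lemma act_rel_ideal:
  assumes "j \<in> rel_ideal"
  shows "act j w = 0"
proof -
  let ?K = "{a \<in> carrier smash_alg. \<forall>w. act a w = 0}"
  have "ideal ?K smash_alg"
  proof (rule idealI[OF S.ring_axioms])
    show "subgroup ?K (add_monoid smash_alg)"
    proof (rule group.subgroupI[OF S.add.is_group])
      show "?K \<noteq> {}"
        using S.zero_closed act_0 unfolding smash_alg_simps(2) by blast
      fix a assume a: "a \<in> ?K"
      then show "inv\<^bsub>add_monoid smash_alg\<^esub> a \<in> ?K"
        using S.a_inv_closed[of a] smash_a_inv[of a] by (simp add: act_uminus a_inv_def)
      fix b assume "b \<in> ?K"
      with a show "a \<otimes>\<^bsub>add_monoid smash_alg\<^esub> b \<in> ?K"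
        using S.add.m_closed[of a b] by (simp add: act_plus smash_alg_simps)
    qed auto
  qed (auto simp: act_mult)
  moreover have "rel_elem \<in> ?K"
  proof -
    have "act rel_elem w = 0" for w
      unfolding rel_elem_def smash_a_minus[OF smash_closed(2)]
      by (simp add: act_minus act_free_alg_emb act_group_algebra_emb rep_minus rep_mult commutator)
    then show ?thesis using rel_elem_closed by simp
  qed
  ultimately have "rel_ideal \<subseteq> ?K"
    unfolding rel_ideal_def by (intro S.genideal_minimal) auto
  then show ?thesis using assms by auto
qed

text \<open>Agreement modulo the ideal on the generators propagates along words, because left
  multiplication keeps the errors in the ideal. Only a congruence is required, since normal ordering
  commutes with \<open>Y\<close> only up to the relation.\<close>

lemma equivariant_act:
  assumes add: "\<And>v w. \<Phi> (v + w) = \<Phi> v + \<Phi> w"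
    and sc: "\<And>c v. \<Phi> (sc c v) = reg_sc c (\<Phi> v)"
    and tr: "\<And>a v. a \<in> prime_field \<Longrightarrow> \<Phi> (tr a v) = reg_tr a (\<Phi> v)"
    and opr: "\<And>z v. \<Phi> (opr z v) - reg_opr z (\<Phi> v) \<in> rel_ideal"
  shows "\<Phi> (act a v) - reg.act a (\<Phi> v) \<in> rel_ideal"
proof -
  have zero: "\<Phi> 0 = 0"
    using add[of 0 0] by simp
  have sumW: "\<Phi> (\<Sum>i\<in>A. f i) = (\<Sum>i\<in>A. \<Phi> (f i))" for A :: "word set" and f
    by (induction A rule: infinite_finite_induct) (simp_all add: zero add)
  have sumK: "\<Phi> (\<Sum>i\<in>A. f i) = (\<Sum>i\<in>A. \<Phi> (f i))" for A :: "'k set" and f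
    by (induction A rule: infinite_finite_induct) (simp_all add: zero add)
  have word: "\<Phi> (word_op ws v) - reg.word_op ws (\<Phi> v) \<in> rel_ideal" for ws v
  proof (induction ws)
    case (Cons z ws)
    have "reg_opr z (\<Phi> (word_op ws v) - reg.word_op ws (\<Phi> v)) \<in> rel_ideal"
      using Cons by (rule rel_ideal_reg)
    then have "reg_opr z (\<Phi> (word_op ws v)) - reg_opr z (reg.word_op ws (\<Phi> v)) \<in> rel_ideal"
      by (simp add: reg.opr_diff)
    from rel_ideal_add[OF opr[of z "word_op ws v"] this]
    have "\<Phi> (opr z (word_op ws v)) - reg_opr z (reg.word_op ws (\<Phi> v)) \<in> rel_ideal"
      by simp
    moreover have "word_op (z # ws) v = opr z (word_op ws v)"
      and "reg.word_op (z # ws) (\<Phi> v) = reg_opr z (reg.word_op ws (\<Phi> v))"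
      by (simp_all add: word_op_def reg.word_op_def)
    ultimately show ?case by (simp only:)
  qed (use rel_ideal_0 in \<open>simp add: word_op_def reg.word_op_def zero_fun_def\<close>)
  have rep: "\<Phi> (rep f v) - reg.rep f (\<Phi> v) \<in> rel_ideal" for f v
  proof -
    have "\<Phi> (rep f v) - reg.rep f (\<Phi> v) =
      (\<Sum>x\<in>Poly_Mapping.keys f. reg_sc (Poly_Mapping.lookup f x)
        (\<Phi> (word_op (letters x) v) - reg.word_op (letters x) (\<Phi> v)))"
      by (simp add: rep_def reg.rep_def sumW sc sum_subtractf reg.sc_diff)
    then show ?thesis
      by (simp add: rel_ideal_sum rel_ideal_reg word)
  qed
  have "\<Phi> (act a v) - reg.act a (\<Phi> v) =
      (\<Sum>c\<in>prime_field. \<Phi> (rep (a (shear c)) (tr c v)) - reg.rep (a (shear c)) (\<Phi> (tr c v)))"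
    by (simp add: act_def reg.act_def sumK sum_subtractf tr)
  also have "\<dots> \<in> rel_ideal"
    by (intro rel_ideal_sum rep)
  finally show ?thesis .
qed

end


section \<open>The polynomial representation\<close>

text \<open>The function \<open>v\<close> stands for the sum over \<open>a\<close> of \<open>g\<^sup>a\<close> times the normally ordered polynomial
  \<open>v a\<close>, whose outer variable is \<open>x\<close> and whose inner variable is \<open>y\<close>; here \<open>g\<^sup>a\<close> is \<open>shear a\<close>.\<close>

definition cst :: "'k :: field \<Rightarrow> 'k poly poly"
  where "cst c = [:[:c:]:]"

definition x_var :: "'k :: field poly poly"
  where "x_var = [:0, 1:]"

definition y_var :: "'k :: field poly poly"
  where "y_var = [:[:0, 1:]:]"

definition V_sc :: "'k :: field \<Rightarrow> ('k \<Rightarrow> 'k poly poly) \<Rightarrow> 'k \<Rightarrow> 'k poly poly"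
  where "V_sc c v a = cst c * v a"

definition V_tr :: "'k :: field \<Rightarrow> ('k \<Rightarrow> 'k poly poly) \<Rightarrow> 'k \<Rightarrow> 'k poly poly"
  where "V_tr b v a = v (a - b)"

lemma cst_simps: "cst (a + b) = cst a + cst b" "cst (a * b) = cst a * cst b" "cst 0 = 0" "cst 1 = 1"
  "cst (a - b) = cst a - cst b"
  by (simp_all add: cst_def one_pCons)

lemma pderiv_x_var_mult: "pderiv (x_var * P) = P + x_var * pderiv P"
  by (simp add: x_var_def pderiv_mult pderiv_pCons)

lemma pderiv_cst_mult: "pderiv (cst c * P) = cst c * pderiv P"
  by (simp add: cst_def pderiv_smult)

lemma fold_coeffs_pCons: "f 0 z = z \<Longrightarrow> fold_coeffs f (pCons a p) z = f a (fold_coeffs f p z)"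
  by (cases "p = 0 \<and> a = 0") (auto simp: fold_coeffs_def cCons_def)

lemma diff_diff_diff_eq: "(t - x - l) - (y - x) = - (y - (t - l))" for t x l y :: "'a :: ab_group_add"
  by (simp add: algebra_simps)

context H_param
begin

text \<open>From \<open>g y = (x + y) g\<close> one gets \<open>y g^a = g^a (y - a x)\<close>.
  Moving \<open>y\<close> to the right of the powers of \<open>x\<close> costs \<open>lam\<close>
  times the derivative in \<open>x\<close>, as \<open>y x = x y - lam\<close> and \<open>lam\<close>
  commutes with \<open>x\<close>. The shift \<open>a - c\<close> accounts for the factor
  \<open>g^c\<close> in \<open>lam\<close>.\<close>

definition V_opr :: "gen \<Rightarrow> ('k \<Rightarrow> 'k poly poly) \<Rightarrow> 'k \<Rightarrow> 'k poly poly"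
  where "V_opr z v a = (case z of X \<Rightarrow> x_var * v a
    | Y \<Rightarrow> y_var * v a - cst a * (x_var * v a)
        - (\<Sum>c\<in>prime_field. cst (lam (shear c)) * pderiv (v (a - c))))"

lemma H_rep_V: "H_rep V_sc V_opr V_tr lam"
proof
  show "V_opr z (v + w) = V_opr z v + V_opr z w" for z v w
    by (cases z) (simp_all add: fun_eq_iff V_opr_def pderiv_add algebra_simps sum.distrib)
  show "V_opr z (V_sc c w) = V_sc c (V_opr z w)" for z c w
    by (cases z)
      (simp_all add: fun_eq_iff V_opr_def V_sc_def pderiv_cst_mult algebra_simps sum_distrib_left)
  show "V_tr a (V_opr Y w) = V_sc a (V_opr X (V_tr a w)) + V_opr Y (V_tr a w)" for a w
    by (simp add: fun_eq_iff V_opr_def V_sc_def V_tr_def cst_simps algebra_simps)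
  show "V_opr X (V_opr Y w) - V_opr Y (V_opr X w) =
      (\<Sum>c\<in>prime_field. V_sc (lam (shear c)) (V_tr c w))" for w
  proof
    fix a
    let ?d = "\<lambda>c. pderiv (w (a - c))"
    \<comment> \<open>The product rule splits off the action of \<open>lam\<close>; the remaining
      terms cancel in the commutator.\<close>
    have "(\<Sum>c\<in>prime_field. cst (lam (shear c)) * pderiv (x_var * w (a - c))) =
        (\<Sum>c\<in>prime_field. cst (lam (shear c)) * w (a - c)) +
        x_var * (\<Sum>c\<in>prime_field. cst (lam (shear c)) * ?d c)"
      unfolding pderiv_x_var_mult sum_distrib_left sum.distrib[symmetric]
      by (rule sum.cong) (simp_all add: algebra_simps)
    then show "(V_opr X (V_opr Y w) - V_opr Y (V_opr X w)) a =
        (\<Sum>c\<in>prime_field. V_sc (lam (shear c)) (V_tr c w)) a"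
      by (simp add: V_opr_def sum_fun_apply V_sc_def V_tr_def right_diff_distrib mult.left_commute)
  qed
qed (simp_all add: fun_eq_iff V_sc_def V_tr_def V_opr_def cst_simps algebra_simps char_pos lam_carrier)

sublocale V: H_rep V_sc V_opr V_tr lam
  by (rule H_rep_V)

section \<open>Normal ordering as a map to the smash product, with \<open>x\<close> to the left of
  \<open>y\<close>\<close>

definition norm_y :: "'k poly \<Rightarrow> 'k ^ 2 ^ 2 \<Rightarrow> 'k free_alg"
  where "norm_y q = fold_coeffs (\<lambda>a s. reg_sc a \<one>\<^bsub>smash_alg\<^esub> + reg_opr Y s) q 0"

definition norm_xy :: "'k poly poly \<Rightarrow> 'k ^ 2 ^ 2 \<Rightarrow> 'k free_alg"
  where "norm_xy P = fold_coeffs (\<lambda>q s. norm_y q + reg_opr X s) P 0"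

lemma norm_y_0 [simp]: "norm_y 0 = 0"
  by (simp add: norm_y_def)

lemma norm_y_pCons: "norm_y (pCons a q) = reg_sc a \<one>\<^bsub>smash_alg\<^esub> + reg_opr Y (norm_y q)"
  unfolding norm_y_def by (rule fold_coeffs_pCons) (simp only: reg.sc_0 reg.opr_right_0 add_0)

lemma norm_xy_0 [simp]: "norm_xy 0 = 0"
  by (simp add: norm_xy_def)

lemma norm_xy_pCons: "norm_xy (pCons q P) = norm_y q + reg_opr X (norm_xy P)"
  unfolding norm_xy_def by (rule fold_coeffs_pCons) (simp only: norm_y_0 reg.opr_right_0 add_0)

lemma norm_y_closed: "norm_y q \<in> carrier smash_alg"
proof (induction q)
  case (pCons a q)
  then show ?case
    using S.a_closed reg_closed(1)[OF S.one_closed] reg_closed(2)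
    by (simp add: norm_y_pCons flip: smash_alg_simps(4))
qed (use S.zero_closed in \<open>simp only: norm_y_0 smash_alg_simps(2)\<close>)

lemma norm_xy_closed: "norm_xy P \<in> carrier smash_alg"
proof (induction P)
  case (pCons q P)
  then show ?case
    using S.a_closed norm_y_closed reg_closed(2)
    by (simp add: norm_xy_pCons flip: smash_alg_simps(4))
qed (use S.zero_closed in \<open>simp only: norm_xy_0 smash_alg_simps(2)\<close>)

lemma norm_y_add: "norm_y (p + q) = norm_y p + norm_y q"
proof (induction p q rule: poly_induct2)
  case (pCons a p b q)
  then show ?case
    by (simp only: add_pCons norm_y_pCons reg.sc_plus reg.opr_add add_ac)
qed simp

lemma norm_xy_add: "norm_xy (P + Q) = norm_xy P + norm_xy Q"
proof (induction P Q rule: poly_induct2)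
  case (pCons p P q Q)
  then show ?case
    by (simp only: add_pCons norm_xy_pCons norm_y_add reg.opr_add add_ac)
qed simp

lemma norm_y_smult: "norm_y (Polynomial.smult c q) = reg_sc c (norm_y q)"
proof (induction q)
  case (pCons a q)
  then show ?case
    by (simp only: smult_pCons norm_y_pCons reg.sc_mult reg.sc_add reg.opr_sc)
qed (simp only: smult_0_right norm_y_0 reg.sc_right_0)

lemma norm_xy_cst: "norm_xy (cst c * P) = reg_sc c (norm_xy P)"
proof (induction P)
  case (pCons q P)
  have "cst c * pCons q P = pCons (Polynomial.smult c q) (cst c * P)"
    by (simp add: cst_def)
  with pCons show ?case
    by (simp only: norm_xy_pCons norm_y_smult reg.sc_add reg.opr_sc)
qed (simp only: mult_zero_right norm_xy_0 reg.sc_right_0)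

lemma norm_xy_x_var: "norm_xy (x_var * P) = reg_opr X (norm_xy P)"
proof -
  have "x_var * P = pCons 0 P"
    by (simp add: x_var_def)
  then show ?thesis
    by (simp only: norm_xy_pCons norm_y_0 add_0)
qed

lemma norm_xy_1: "norm_xy 1 = \<one>\<^bsub>smash_alg\<^esub>"
  by (simp only: one_pCons norm_xy_pCons norm_y_pCons norm_y_0 norm_xy_0 reg.opr_right_0
      reg.sc_1 add_0_right)

lemma norm_xy_minus: "norm_xy (P - Q) = norm_xy P - norm_xy Q"
  using norm_xy_add[of "P - Q" Q] by (simp add: eq_diff_eq)

lemma norm_xy_sum: "norm_xy (\<Sum>i\<in>A. f i) = (\<Sum>i\<in>A. norm_xy (f i))"
  by (induction A rule: infinite_finite_induct) (simp_all add: norm_xy_add)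

lemma reg_lam_add: "reg_lam (s + s') = reg_lam s + reg_lam s'"
  by (simp only: reg_lam_def reg.tr_add reg.sc_add sum.distrib)

lemma reg_lam_X: "reg_lam (reg_opr X s) = reg_opr X (reg_lam s)"
  by (simp only: reg_lam_def reg.tr_X reg.opr_sc reg.opr_sum)

text \<open>Induction on the polynomial in \<open>x\<close>: the commutator relation carries
  \<open>Y\<close> past one factor \<open>x\<close> and produces the extra term of the product rule.
  On polynomials in \<open>y\<close> alone there is no error.\<close>

lemma reg_opr_Y_norm_xy:
  "reg_opr Y (norm_xy P) - (norm_xy (y_var * P) - reg_lam (norm_xy (pderiv P))) \<in> rel_ideal"
proof (induction P)
  case 0
  have "reg_lam 0 = 0"
    by (simp only: reg_lam_def reg.tr_right_0 reg.sc_right_0 sum.neutral_const)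
  then show ?case
    using rel_ideal_0 by (simp only: pderiv_0 mult_zero_right norm_xy_0 reg.opr_right_0 diff_0_right)
next
  case (pCons q P)
  define s where "s = norm_xy P"
  \<comment> \<open>\<open>A\<close> is the error in the induction hypothesis and \<open>B\<close>
    an instance of the relation; \<open>x A - B\<close> is the error to be shown in the
    ideal.\<close>
  define A where "A = reg_opr Y s - (norm_xy (y_var * P) - reg_lam (norm_xy (pderiv P)))"
  define B where "B = reg_opr X (reg_opr Y s) - reg_opr Y (reg_opr X s) - reg_lam s"
  have "y_var * pCons q P = pCons (pCons 0 q) (y_var * P)"
    by (simp add: y_var_def)
  then have 1: "norm_xy (y_var * pCons q P) = reg_opr Y (norm_y q) + reg_opr X (norm_xy (y_var * P))"
    by (simp only: norm_xy_pCons norm_y_pCons reg.sc_0 add_0)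
  have 2: "reg_lam (norm_xy (pderiv (pCons q P))) = reg_lam s + reg_opr X (reg_lam (norm_xy (pderiv P)))"
    by (simp only: pderiv_pCons norm_xy_add norm_xy_pCons norm_y_0 add_0 reg_lam_add reg_lam_X s_def)
  have "reg_opr X A - B \<in> rel_ideal"
    unfolding A_def B_def using pCons rel_ideal_reg(2) rel_ideal_diff rel_ideal_commutator norm_xy_closed
    by (simp only: s_def)
  moreover have "reg_opr X A - B = reg_opr Y (norm_xy (pCons q P)) -
      (norm_xy (y_var * pCons q P) - reg_lam (norm_xy (pderiv (pCons q P))))"
    unfolding 1 2 A_def B_def norm_xy_pCons s_def reg.opr_diff reg.opr_add
    by (simp only: algebra_simps)
  ultimately show ?case by (simp only:)
qed

definition norm_order :: "('k \<Rightarrow> 'k poly poly) \<Rightarrow> 'k ^ 2 ^ 2 \<Rightarrow> 'k free_alg"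
  where "norm_order v = (\<Sum>a\<in>prime_field. reg_tr a (norm_xy (v a)))"

lemma norm_order_cong: "(\<And>a. a \<in> prime_field \<Longrightarrow> v a = w a) \<Longrightarrow> norm_order v = norm_order w"
  unfolding norm_order_def by (rule sum.cong) simp_all

lemma norm_order_add: "norm_order (v + w) = norm_order v + norm_order w"
  by (simp only: norm_order_def plus_fun_apply norm_xy_add reg.tr_add sum.distrib)

lemma norm_order_sc: "norm_order (V_sc c v) = reg_sc c (norm_order v)"
  by (simp only: norm_order_def V_sc_def norm_xy_cst reg.tr_sc reg.sc_sum)

lemma norm_order_tr:
  assumes "b \<in> prime_field"
  shows "norm_order (V_tr b v) = reg_tr b (norm_order v)"
proof -
  have "norm_order (V_tr b v) = (\<Sum>a\<in>prime_field. reg_tr a (norm_xy (v (a - b))))"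
    by (simp only: norm_order_def V_tr_def)
  also have "\<dots> = (\<Sum>a\<in>prime_field. reg_tr (a + b) (norm_xy (v (a + b - b))))"
    by (rule sum_prime_field_shift[OF char_pos assms, symmetric])
  also have "\<dots> = reg_tr b (norm_order v)"
    by (simp only: norm_order_def reg.tr_sum reg.tr_plus[symmetric] add_diff_cancel_right' add.commute)
  finally show ?thesis .
qed

lemma norm_order_closed: "norm_order v \<in> carrier smash_alg"
  unfolding norm_order_def by (intro smash_sum_closed reg_closed norm_xy_closed)

lemma norm_order_X: "norm_order (V_opr X v) = reg_opr X (norm_order v)"
  by (simp only: norm_order_def V_opr_def gen.case norm_xy_x_var reg.tr_X reg.opr_sum)

text \<open>Passing \<open>Y\<close> through the group elements is exact; the error comes only from
  reordering each polynomial, where \<open>reg_opr_Y_norm_xy\<close> applies. Translating the outer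
  index collects the double sum into \<open>reg_lam\<close>.\<close>

lemma norm_order_Y: "norm_order (V_opr Y v) - reg_opr Y (norm_order v) \<in> rel_ideal"
proof -
  let ?F = "prime_field :: 'k set"
  let ?n = "\<lambda>a. norm_xy (v a)" and ?d = "\<lambda>a. norm_xy (pderiv (v a))"
  have "reg_opr Y (norm_order v) =
      (\<Sum>a\<in>?F. reg_tr a (reg_opr Y (?n a)) - reg_tr a (reg_sc a (reg_opr X (?n a))))"
    by (simp only: norm_order_def reg.opr_sum reg.tr_Y reg.tr_sc reg.tr_X add_diff_cancel_left')
  moreover have "norm_order (V_opr Y v) =
      (\<Sum>a\<in>?F. reg_tr a (norm_xy (y_var * v a)) - reg_tr a (reg_sc a (reg_opr X (?n a)))) -
      (\<Sum>a\<in>?F. \<Sum>c\<in>?F. reg_tr a (reg_sc (lam (shear c)) (?d (a - c))))"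
    by (simp only: norm_order_def V_opr_def gen.case norm_xy_minus norm_xy_sum norm_xy_cst norm_xy_x_var
        reg.tr_diff reg.tr_sum sum_subtractf)
  moreover have "(\<Sum>a\<in>?F. \<Sum>c\<in>?F. reg_tr a (reg_sc (lam (shear c)) (?d (a - c)))) =
      (\<Sum>a\<in>?F. reg_tr a (reg_lam (?d a)))"
  proof -
    have "(\<Sum>a\<in>?F. \<Sum>c\<in>?F. reg_tr a (reg_sc (lam (shear c)) (?d (a - c)))) =
        (\<Sum>c\<in>?F. \<Sum>a\<in>?F. reg_tr a (reg_sc (lam (shear c)) (?d (a - c))))"
      by (rule sum.swap)
    also have "\<dots> = (\<Sum>c\<in>?F. \<Sum>a\<in>?F. reg_tr (a + c) (reg_sc (lam (shear c)) (?d (a + c - c))))"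
      by (rule sum.cong[OF refl]) (rule sum_prime_field_shift[OF char_pos, symmetric])
    also have "\<dots> = (\<Sum>a\<in>?F. \<Sum>c\<in>?F. reg_tr (a + c) (reg_sc (lam (shear c)) (?d (a + c - c))))"
      by (rule sum.swap)
    also have "\<dots> = (\<Sum>a\<in>?F. reg_tr a (reg_lam (?d a)))"
      by (simp only: reg_lam_def reg.tr_sum reg.tr_plus reg.tr_sc add_diff_cancel_right')
    finally show ?thesis .
  qed
  ultimately have "norm_order (V_opr Y v) - reg_opr Y (norm_order v) =
      (\<Sum>a\<in>?F. - reg_tr a (reg_opr Y (?n a) - (norm_xy (y_var * v a) - reg_lam (?d a))))"
    by (simp only: reg.tr_diff sum_subtractf sum_negf diff_diff_diff_eq)
  also have "\<dots> \<in> rel_ideal"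
    by (intro rel_ideal_sum rel_ideal_uminus rel_ideal_reg(3) reg_opr_Y_norm_xy)
  finally show ?thesis .
qed

text \<open>The unit of the algebra in normal form; applying an element to it yields a normal form
  of that element.\<close>

definition vacuum :: "'k \<Rightarrow> 'k poly poly"
  where "vacuum a = (if a = 0 then 1 else 0)"

lemma norm_order_supported_0:
  assumes "\<And>a. a \<noteq> 0 \<Longrightarrow> v a = 0"
  shows "norm_order v = norm_xy (v 0)"
proof -
  have "norm_order v = (\<Sum>a\<in>{0}. reg_tr a (norm_xy (v a)))"
    unfolding norm_order_def
    by (rule sum.mono_neutral_right)
      (use assms in \<open>auto simp: finite_prime_field[OF char_pos] simp del: zero_fun_apply\<close>)
  then show ?thesis by (simp only: sum.insert[OF finite.emptyI] sum.empty empty_iff not_False_eq_True reg.tr_0 add_0_right)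
qed

text \<open>Normal ordering is a left inverse, modulo the ideal, of applying elements to the vacuum.
  This is the splitting that makes the algebra a direct summand of the polynomial
  representation.\<close>

lemma norm_order_act_vacuum:
  assumes "s \<in> carrier smash_alg"
  shows "norm_order (V.act s vacuum) - s \<in> rel_ideal"
proof -
  have "norm_order (V_opr z v) - reg_opr z (norm_order v) \<in> rel_ideal" for z v
    using norm_order_Y rel_ideal_0 by (cases z) (simp_all only: norm_order_X diff_self)
  then have "norm_order (V.act s vacuum) - reg.act s (norm_order vacuum) \<in> rel_ideal"
    by (intro V.equivariant_act norm_order_add norm_order_sc norm_order_tr)
  moreover have "norm_order vacuum = \<one>\<^bsub>smash_alg\<^esub>"
    using norm_order_supported_0[of vacuum] norm_xy_1 by (simp only: vacuum_def if_False simp_thms if_True)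
  ultimately show ?thesis
    by (simp only: act_regular_one[OF char_pos assms])
qed

end


section \<open>Exactness on \<open>H\<^sub>\<lambda>\<close>\<close>

definition group_sum :: "'k :: field ^ 2 ^ 2 \<Rightarrow> 'k free_alg"
  where "group_sum = (\<Sum>c\<in>prime_field. group_elem c)"

context smash_rep
begin

lemma act_sum_left: "act (\<Sum>i\<in>A. f i) w = (\<Sum>i\<in>A. act (f i) w)"
  by (induction A rule: infinite_finite_induct) (simp_all only: sum.infinite sum.empty sum.insert act_0 act_plus not_False_eq_True)

lemma act_group_sum: "act group_sum w = (\<Sum>c\<in>prime_field. tr c w)"
  by (simp add: group_sum_def act_sum_left act_group_elem)

lemma act_group_diff: "act (group_elem 1 - \<one>\<^bsub>smash_alg\<^esub>) w = tr 1 w - w"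
  by (simp only: act_minus act_group_elem[OF prime_field_1] act_one)

end

context H_param
begin

lemma group_sum_closed: "group_sum \<in> carrier (smash_alg :: ('k ^ 2 ^ 2 \<Rightarrow> 'k free_alg) ring)"
  unfolding group_sum_def by (intro smash_sum_closed smash_closed)

lemma group_diff_closed: "group_elem 1 - \<one>\<^bsub>smash_alg\<^esub> \<in> carrier (smash_alg :: ('k ^ 2 ^ 2 \<Rightarrow> 'k free_alg) ring)"
  by (intro smash_diff_closed smash_closed S.one_closed prime_field_1)

lemma norm_order_minus: "norm_order (v - w) = norm_order v - norm_order w"
  using norm_order_add[of "v - w" w] by (simp add: eq_diff_eq)

lemma norm_order_sum: "norm_order (\<Sum>i\<in>A. f i) = (\<Sum>i\<in>A. norm_order (f i))"
proof -
  have "norm_order 0 = 0"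
    using norm_order_minus[of 0 0] by (simp only: diff_self)
  then show ?thesis
    by (induction A rule: infinite_finite_induct)
      (simp_all only: sum.infinite sum.empty sum.insert norm_order_add not_False_eq_True)
qed

text \<open>An invariant function is constant on the prime field, so there it is the norm of its
  part at \<open>0\<close>. The equality is established only on the prime field, whose values are
  all that \<open>norm_order\<close> sees.\<close>

lemma V_exact_diff:
  assumes "V_tr 1 v = v"
  obtains w where "norm_order v = group_sum \<otimes>\<^bsub>smash_alg\<^esub> norm_order w"
proof -
  define w :: "'k \<Rightarrow> 'k poly poly" where "w a = (if a = 0 then v 0 else 0)" for a
  have v: "v (of_nat n) = v 0" for n
  proof (induction n)
    case (Suc n)
    have "v (of_nat n) = v (of_nat (Suc n))"
      using fun_cong[OF assms, of "of_nat (Suc n)"] by (simp add: V_tr_def)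
    with Suc show ?case by (simp only:)
  qed simp
  have "(\<Sum>c\<in>prime_field. V_tr c w) a = v a" if a: "a \<in> prime_field" for a
  proof -
    obtain n where "a = of_nat n"
      using a by (auto simp: prime_field_def)
    then have "v a = v 0" by (simp only: v)
    have "(\<Sum>c\<in>prime_field. V_tr c w) a = (\<Sum>c\<in>prime_field. if c = a then v 0 else 0)"
      by (simp add: sum_fun_apply V_tr_def w_def) (rule sum.cong, auto)
    also have "\<dots> = v a"
      using a \<open>v a = v 0\<close> by (simp add: finite_prime_field[OF char_pos])
    finally show ?thesis .
  qed
  then have "norm_order v = norm_order (\<Sum>c\<in>prime_field. V_tr c w)"
    by (intro norm_order_cong) simp
  also have "\<dots> = (\<Sum>c\<in>prime_field. reg_tr c (norm_order w))"
    by (simp add: norm_order_sum norm_order_tr)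
  also have "\<dots> = group_sum \<otimes>\<^bsub>smash_alg\<^esub> norm_order w"
    using act_regular[OF char_pos norm_order_closed, of group_sum w] by (simp add: reg.act_group_sum)
  finally show ?thesis by (rule that)
qed

lemma V_exact_sum:
  assumes "(\<Sum>c\<in>prime_field. V_tr c v) = 0"
  obtains w where "norm_order v = (group_elem 1 - \<one>\<^bsub>smash_alg\<^esub>) \<otimes>\<^bsub>smash_alg\<^esub> norm_order w"
proof -
  define p where "p = CHAR('k)"
  define idx :: "'k \<Rightarrow> nat" where "idx = the_inv_into {..<p} of_nat"
  \<comment> \<open>A negated partial sum over the natural representatives below \<open>p\<close>,
    so that \<open>w (a - 1) - w a\<close> telescopes to \<open>v a\<close>.\<close>
  define w :: "'k \<Rightarrow> 'k poly poly" where "w a = - (\<Sum>j\<le>idx a. v (of_nat j))" for a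
  have p: "p > 0"
    using char_pos by (simp add: p_def)
  have idx: "idx (of_nat i) = i" if "i < p" for i
    unfolding idx_def using that by (intro the_inv_into_f_f inj_on_of_nat_CHAR[where 'k = 'k, folded p_def]) auto
  have "(\<Sum>j<p. v (of_nat j)) = (\<Sum>a\<in>prime_field. v a)"
    unfolding prime_field_eq[OF char_pos] p_def
    by (simp add: sum.reindex[OF inj_on_of_nat_CHAR])
  also have "\<dots> = (\<Sum>c\<in>prime_field. v (- c))"
    by (rule sum.reindex_bij_witness[where i = uminus and j = uminus])
      (auto simp: prime_field_uminus[OF char_pos])
  also have "\<dots> = (\<Sum>c\<in>prime_field. V_tr c v) 0"
    by (simp only: sum_fun_apply V_tr_def diff_0)
  finally have total: "(\<Sum>j<p. v (of_nat j)) = 0"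
    by (simp add: assms)
  have "(V_tr 1 w - w) a = v a" if a: "a \<in> prime_field" for a
  proof -
    obtain i where i: "a = of_nat i" "i < p"
      using a unfolding prime_field_eq[OF char_pos] p_def by blast
    show ?thesis
    proof (cases i)
      \<comment> \<open>The wrap-around: the index before \<open>0\<close> is \<open>p - 1\<close>,
        where the partial sum is the total sum and vanishes.\<close>
      case 0
      have "idx (- 1) = p - 1"
      proof -
        have "of_nat (p - 1) = (- 1 :: 'k)"
          using p by (simp add: of_nat_diff p_def)
        then show ?thesis using idx[of "p - 1"] p by simp
      qed
      moreover have "{..p - 1} = {..<p}"
        using p by auto
      ultimately show ?thesis
        using i idx[OF p] 0 total by (simp add: V_tr_def w_def)
    next
      case (Suc n)
      then show ?thesis
        using i idx[of n] idx[of "Suc n"] by (simp add: V_tr_def w_def)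
    qed
  qed
  then have "norm_order v = norm_order (V_tr 1 w - w)"
    by (intro norm_order_cong) simp
  also have "\<dots> = reg_tr 1 (norm_order w) - norm_order w"
    by (simp only: norm_order_minus norm_order_tr prime_field_1)
  also have "\<dots> = (group_elem 1 - \<one>\<^bsub>smash_alg\<^esub>) \<otimes>\<^bsub>smash_alg\<^esub> norm_order w"
    by (simp only: act_regular[OF char_pos norm_order_closed, symmetric] reg.act_group_diff)
  finally show ?thesis by (rule that)
qed

text \<open>Acting on the vacuum turns the congruence into an equation in the polynomial
  representation; its solution is carried back by \<open>norm_order\<close>.\<close>

lemma rel_exact_diff:
  assumes s: "s \<in> carrier smash_alg"
    and ker: "(group_elem 1 - \<one>\<^bsub>smash_alg\<^esub>) \<otimes>\<^bsub>smash_alg\<^esub> s \<in> rel_ideal"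
  obtains w where "w \<in> carrier smash_alg" "s - group_sum \<otimes>\<^bsub>smash_alg\<^esub> w \<in> rel_ideal"
proof -
  define v where "v = V.act s vacuum"
  have "V_tr 1 v - v = 0"
    using V.act_rel_ideal[OF ker, of vacuum] by (simp only: V.act_mult V.act_group_diff v_def)
  then have "V_tr 1 v = v"
    by (simp only: right_minus_eq)
  then obtain w where "norm_order v = group_sum \<otimes>\<^bsub>smash_alg\<^esub> norm_order w"
    by (rule V_exact_diff)
  moreover have "s - norm_order v \<in> rel_ideal"
    using rel_ideal_uminus[OF norm_order_act_vacuum[OF s]] by (simp only: minus_diff_eq v_def)
  ultimately show ?thesis
    using that[OF norm_order_closed] by (simp only:)
qed

lemma rel_exact_sum:
  assumes s: "s \<in> carrier smash_alg"
    and ker: "group_sum \<otimes>\<^bsub>smash_alg\<^esub> s \<in> rel_ideal"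
  obtains w where "w \<in> carrier smash_alg"
    "s - (group_elem 1 - \<one>\<^bsub>smash_alg\<^esub>) \<otimes>\<^bsub>smash_alg\<^esub> w \<in> rel_ideal"
proof -
  define v where "v = V.act s vacuum"
  have "(\<Sum>c\<in>prime_field. V_tr c v) = 0"
    using V.act_rel_ideal[OF ker, of vacuum] by (simp only: V.act_mult V.act_group_sum v_def)
  then obtain w where "norm_order v = (group_elem 1 - \<one>\<^bsub>smash_alg\<^esub>) \<otimes>\<^bsub>smash_alg\<^esub> norm_order w"
    by (rule V_exact_sum)
  moreover have "s - norm_order v \<in> rel_ideal"
    using rel_ideal_uminus[OF norm_order_act_vacuum[OF s]] by (simp only: minus_diff_eq v_def)
  ultimately show ?thesis
    using that[OF norm_order_closed] by (simp only:)
qed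

end


section \<open>A representation on two copies of the group algebra\<close>

text \<open>To have a commutative ring type, \<open>kG\<close> is enlarged to the group algebra of the additive group
  of \<open>k\<close>; the element \<open>g\<^sup>c\<close> becomes \<open>grp c\<close>, and \<open>D f = x (euler f)\<close>. The pair \<open>(a, b)\<close> stands for
  \<open>a + b x\<close>.\<close>

definition euler :: "('k :: field \<Rightarrow>\<^sub>0 'k) \<Rightarrow> 'k \<Rightarrow>\<^sub>0 'k"
  where "euler f = (\<Sum>x\<in>Poly_Mapping.keys f. Poly_Mapping.single x (x * Poly_Mapping.lookup f x))"

lemma lookup_euler: "Poly_Mapping.lookup (euler f) x = x * Poly_Mapping.lookup f x"
  by (auto simp: euler_def lookup_sum lookup_single when_def in_keys_iff)

lemma euler_add: "euler (f + g) = euler f + euler g"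
  by (rule poly_mapping_eqI) (simp add: lookup_euler lookup_add distrib_left)

lemma euler_0 [simp]: "euler 0 = 0"
  by (simp add: euler_def)

lemma euler_single [simp]: "euler (Poly_Mapping.single a b) = Poly_Mapping.single a (a * b)"
  by (simp add: euler_def)

text \<open>Basis elements are eigenvectors whose eigenvalues add under multiplication, which makes
  \<open>euler\<close> a derivation.\<close>

lemma euler_mult: "euler (f * g) = euler f * g + f * euler g"
proof (induction f rule: poly_mapping_single_induct)
  case (single a b)
  show ?case
    by (induction g rule: poly_mapping_single_induct)
      (simp_all add: mult_single euler_add distrib_left single_add[symmetric] algebra_simps)
qed (simp_all add: euler_add distrib_right)

lemma euler_1 [simp]: "euler 1 = 0"
  using euler_single[of 0 1] by simp

lemma euler_minus: "euler (f - g) = euler f - euler g"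
  using euler_add[of "f - g" g] by (simp add: eq_diff_eq)

lemma euler_sum: "euler (\<Sum>i\<in>A. f i) = (\<Sum>i\<in>A. euler (f i))"
  by (induction A rule: infinite_finite_induct) (simp_all add: euler_add)

lemma euler_power_Suc: "euler (f ^ Suc n) = of_nat (Suc n) * f ^ n * euler f"
proof (induction n)
  case (Suc n)
  have "euler (f ^ Suc (Suc n)) = euler f * f ^ Suc n + f * euler (f ^ Suc n)"
    by (simp only: power_Suc[of f "Suc n"] euler_mult)
  also have "\<dots> = of_nat (Suc (Suc n)) * f ^ Suc n * euler f"
    unfolding Suc by (simp add: algebra_simps)
  finally show ?case .
qed simp

text \<open>By Pascal's rule, consecutive coefficients add up to \<open>Suc q choose Suc k\<close>,
  a multiple of the prime, so they alternate in sign starting from \<open>1\<close>.\<close>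

lemma of_nat_choose_prime:
  assumes "prime (Suc q)" "of_nat (Suc q) = (0 :: 'a :: comm_ring_1)" "k \<le> q"
  shows "(of_nat (q choose k) :: 'a) = (- 1) ^ k"
  using assms(3)
proof (induction k)
  case (Suc k)
  have "Suc q dvd (Suc q choose Suc k)"
    by (rule dvd_choose_prime) (use assms(1) Suc in auto)
  then obtain r where r: "Suc q choose Suc k = Suc q * r" ..
  have "of_nat (Suc q choose Suc k) = (0 :: 'a)"
    unfolding r of_nat_mult assms(2) by simp
  then have "of_nat (q choose k) + of_nat (q choose Suc k) = (0 :: 'a)"
    by (simp only: binomial_Suc_Suc of_nat_add)
  then show ?case
    using Suc by (simp add: add_eq_0_iff)
qed simp

definition grp :: "'k :: field \<Rightarrow> 'k \<Rightarrow>\<^sub>0 'k"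
  where "grp a = Poly_Mapping.single a 1"

definition B_const :: "'k :: field \<Rightarrow> 'k \<Rightarrow>\<^sub>0 'k"
  where "B_const c = Poly_Mapping.single 0 c"

lemma grp_add: "grp (a + b) = grp a * grp b" and grp_0: "grp 0 = 1"
  and euler_grp: "euler (grp a) = B_const a * grp a"
  by (simp_all add: grp_def B_const_def mult_single)

lemma B_const_add: "B_const (a + b) = B_const a + B_const b"
  and B_const_mult: "B_const (a * b) = B_const a * B_const b"
  and B_const_1: "B_const 1 = 1" and B_const_0: "B_const 0 = 0"
  and euler_B_const: "euler (B_const c) = 0"
  by (simp_all add: B_const_def mult_single single_add)

lemma grp_of_nat: "grp (of_nat n) = grp 1 ^ n"
  by (induction n) (simp_all add: grp_add grp_0)

definition B_sc :: "'k :: field \<Rightarrow> ('k \<Rightarrow>\<^sub>0 'k) \<times> ('k \<Rightarrow>\<^sub>0 'k) \<Rightarrow> ('k \<Rightarrow>\<^sub>0 'k) \<times> ('k \<Rightarrow>\<^sub>0 'k)"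
  where "B_sc c w = (B_const c * fst w, B_const c * snd w)"

definition B_tr :: "'k :: field \<Rightarrow> ('k \<Rightarrow>\<^sub>0 'k) \<times> ('k \<Rightarrow>\<^sub>0 'k) \<Rightarrow> ('k \<Rightarrow>\<^sub>0 'k) \<times> ('k \<Rightarrow>\<^sub>0 'k)"
  where "B_tr c w = (grp c * fst w, grp c * snd w)"

locale H_param_t0 = H_param lam for lam :: "'k :: field ^ 2 ^ 2 \<Rightarrow> 'k" +
  assumes lam_0: "lam (shear 0) = 0"
    and prime_char: "prime CHAR('k)" and odd_char: "odd CHAR('k)"
begin

definition B_lam :: "'k \<Rightarrow>\<^sub>0 'k"
  where "B_lam = (\<Sum>c\<in>prime_field. B_const (lam (shear c)) * grp c)"

text \<open>This is the \<open>F\<close> with \<open>x\<^sup>2 - F\<close> central. Division by \<open>c = 0\<close> is harmless, as the constant term of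
  \<open>\<lambda>\<close> is \<open>0\<close>; subtracting \<open>1\<close> makes \<open>F\<close> divisible by \<open>g - 1\<close>.\<close>

definition B_sq :: "'k \<Rightarrow>\<^sub>0 'k"
  where "B_sq = (\<Sum>c\<in>prime_field. B_const (2 * lam (shear c) / c) * (grp c - 1))"

lemma euler_B_sq: "euler B_sq = 2 * B_lam"
proof -
  have "euler (B_const (2 * lam (shear c) / c) * (grp c - 1)) = 2 * (B_const (lam (shear c)) * grp c)" for c
  \<comment> \<open>Nothing in the range of \<open>euler\<close> has a constant term. At
    \<open>c = 0\<close> the equation therefore rests on the vanishing constant term of
    \<open>lam\<close>.\<close>
  proof (cases "c = 0")
    case False
    have "euler (B_const (2 * lam (shear c) / c) * (grp c - 1)) =
        (B_const (2 * lam (shear c) / c) * B_const c) * grp c"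
      by (simp add: euler_mult euler_minus euler_B_const euler_grp mult.assoc)
    also have "B_const (2 * lam (shear c) / c) * B_const c = B_const (lam (shear c) + lam (shear c))"
      using False by (simp flip: B_const_mult)
    finally show ?thesis
      by (simp only: B_const_add mult_2 distrib_right)
  qed (simp add: lam_0 B_const_0)
  then show ?thesis
    by (simp add: B_sq_def B_lam_def euler_sum sum_distrib_left)
qed

text \<open>With \<open>D b = x (euler b)\<close> and \<open>D x = lam\<close>, the product rule
  gives \<open>D (a + b x) = (euler b) x^2 + b lam + (euler a) x\<close>; then \<open>x^2\<close> is
  replaced by \<open>B_sq\<close>.\<close>

definition B_opr :: "gen \<Rightarrow> ('k \<Rightarrow>\<^sub>0 'k) \<times> ('k \<Rightarrow>\<^sub>0 'k) \<Rightarrow> ('k \<Rightarrow>\<^sub>0 'k) \<times> ('k \<Rightarrow>\<^sub>0 'k)"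
  where "B_opr z w = (case z of X \<Rightarrow> (snd w * B_sq, fst w)
    | Y \<Rightarrow> (- (euler (snd w) * B_sq + snd w * B_lam), - euler (fst w)))"

lemma fst_sum: "fst (\<Sum>i\<in>A. f i) = (\<Sum>i\<in>A. fst (f i))" and snd_sum: "snd (\<Sum>i\<in>A. f i) = (\<Sum>i\<in>A. snd (f i))"
  by (induction A rule: infinite_finite_induct) simp_all

text \<open>The commutator of \<open>x\<close> with \<open>- D\<close> is \<open>D x\<close>, that
  is \<open>lam\<close>; \<open>euler_B_sq\<close> makes \<open>D\<close> compatible with
  \<open>x^2 = B_sq\<close>.\<close>

lemma H_rep_B: "H_rep B_sc B_opr B_tr lam"
proof
  show "B_opr z (v + w) = B_opr z v + B_opr z w" for z v w
    by (cases z) (simp_all add: prod_eq_iff B_opr_def euler_add algebra_simps)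
  show "B_opr z (B_sc c w) = B_sc c (B_opr z w)" for z c w
    by (cases z) (simp_all add: prod_eq_iff B_opr_def B_sc_def euler_mult euler_B_const algebra_simps)
  show "B_tr a (B_opr Y w) = B_sc a (B_opr X (B_tr a w)) + B_opr Y (B_tr a w)" for a w
    by (simp add: prod_eq_iff B_opr_def B_sc_def B_tr_def euler_mult euler_grp algebra_simps)
  show "B_opr X (B_opr Y w) - B_opr Y (B_opr X w) =
      (\<Sum>c\<in>prime_field. B_sc (lam (shear c)) (B_tr c w))" for w
  proof -
    have "(\<Sum>c\<in>prime_field. B_const (lam (shear c)) * (grp c * f)) = B_lam * f" for f
      by (simp add: B_lam_def sum_distrib_right mult.assoc)
    then have "(\<Sum>c\<in>prime_field. B_sc (lam (shear c)) (B_tr c w)) = (B_lam * fst w, B_lam * snd w)"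
      by (simp add: prod_eq_iff fst_sum snd_sum B_sc_def B_tr_def)
    then show ?thesis
      by (simp add: B_opr_def euler_mult euler_B_sq prod_eq_iff algebra_simps)
  qed
qed (simp_all add: prod_eq_iff B_sc_def B_tr_def B_opr_def B_const_add B_const_mult B_const_1 grp_add
    grp_0 algebra_simps char_pos lam_carrier)

sublocale B: H_rep B_sc B_opr B_tr lam
  by (rule H_rep_B)

section \<open>The submodule cut out by powers of \<open>g - 1\<close>\<close>

definition half :: nat
  where "half = CHAR('k) div 2"

lemma CHAR_eq: "CHAR('k) = Suc (2 * half)"
  using odd_char by (simp add: half_def)

lemma half_pos: "half > 0"
  using prime_gt_1_nat[OF prime_char] by (simp add: CHAR_eq)

definition u :: "'k \<Rightarrow>\<^sub>0 'k"
  where "u = grp 1 - 1"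

lemma euler_u: "euler u = grp 1"
  by (simp add: u_def euler_minus euler_grp B_const_1)

lemma u_dvd_B_sq: "u dvd B_sq"
  unfolding B_sq_def
proof (rule dvd_sum, rule dvd_mult)
  fix c :: 'k assume "c \<in> prime_field"
  then obtain n where "c = of_nat n"
    by (auto simp: prime_field_def)
  then show "u dvd grp c - 1"
    using one_diff_power_eq'[of "grp 1" n] by (simp add: u_def grp_of_nat power_diff_1_eq)
qed

lemma of_nat_CHAR_B: "of_nat CHAR('k) = (0 :: 'k \<Rightarrow>\<^sub>0 'k)"
  using single_of_nat[of "CHAR('k)", where ?'b = 'k and ?'a = 'k] by simp

definition B_sub :: "(('k \<Rightarrow>\<^sub>0 'k) \<times> ('k \<Rightarrow>\<^sub>0 'k)) set"
  where "B_sub = {w. u ^ half * fst w = 0 \<and> u ^ Suc half * snd w = 0}"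

text \<open>For \<open>x\<close>, the factor \<open>u\<close> of \<open>B_sq\<close> offsets the
  difference between the two exponents. For \<open>y\<close>, both annihilation conditions are
  differentiated; in the first entry this leaves the factor \<open>2 (half + 1) - 1\<close>, which
  is the characteristic and so vanishes.\<close>

lemma B_sub_opr:
  assumes w: "w \<in> B_sub"
  shows "B_opr z w \<in> B_sub"
proof (cases w)
  case (Pair a b)
  let ?g = "grp 1 :: 'k \<Rightarrow>\<^sub>0 'k" and ?n = "of_nat (Suc half) :: 'k \<Rightarrow>\<^sub>0 'k"
  have a: "u ^ half * a = 0" and b: "u ^ Suc half * b = 0"
    using w by (simp_all add: B_sub_def Pair)
  have a': "u ^ Suc half * a = 0"
    using a by (simp add: mult.assoc)
  obtain F where F: "B_sq = u * F"
    using u_dvd_B_sq by (elim dvdE)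
  have Eu: "euler (u ^ Suc half) = ?n * u ^ half * ?g"
    by (simp only: euler_power_Suc euler_u)
  \<comment> \<open>Differentiation lowers the exponent of \<open>u\<close> by one, so it is applied
    to \<open>u ^ Suc half * a\<close>; the lower power \<open>u ^ half\<close> still kills
    \<open>a\<close>.\<close>
  have Ea: "u ^ Suc half * euler a = 0"
  proof -
    have "euler (u ^ Suc half * a) = ?n * ?g * (u ^ half * a) + u ^ Suc half * euler a"
      unfolding euler_mult Eu by (simp only: mult_ac)
    then show ?thesis by (simp only: a a' mult_zero_right euler_0 add_0)
  qed
  have Eb: "u ^ Suc half * euler b = - (?n * u ^ half * ?g * b)"
  proof -
    have "euler (u ^ Suc half * b) = ?n * u ^ half * ?g * b + u ^ Suc half * euler b"
      unfolding euler_mult Eu ..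
    then show ?thesis by (metis add_eq_0_iff b euler_0)
  qed
  show ?thesis
  proof (cases z)
    case X
    have "u ^ half * (b * B_sq) = (u ^ Suc half * b) * F"
      by (simp only: F power_Suc mult_ac)
    then show ?thesis
      using b a' by (simp add: B_sub_def B_opr_def Pair X)
  next
    case Y
    \<comment> \<open>The product rule for \<open>B_sq = u F\<close> with
      \<open>euler u = g\<close>, compared with \<open>euler_B_sq\<close>.\<close>
    have gF: "?g * F = 2 * B_lam - u * euler F"
      using euler_B_sq by (simp add: F euler_mult euler_u algebra_simps)
    have n2: "2 * ?n - 1 = 0"
      using of_nat_CHAR_B by (simp add: CHAR_eq algebra_simps)
    have "u ^ half * (euler b * B_sq + b * B_lam) = (u ^ Suc half * euler b) * F + u ^ half * b * B_lam"
      by (simp add: F algebra_simps)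
    also have "\<dots> = u ^ half * b * (B_lam - ?n * (?g * F))"
      unfolding Eb by (simp add: algebra_simps del: of_nat_Suc)
    also have "\<dots> = ?n * euler F * (u ^ Suc half * b) - u ^ half * b * B_lam * (2 * ?n - 1)"
      unfolding gF by (simp add: algebra_simps)
    also have "\<dots> = 0"
      by (simp only: b n2 mult_zero_right diff_0_right)
    finally have "u ^ half * - (euler b * B_sq + b * B_lam) = 0"
      by (simp only: mult_minus_right minus_zero)
    then show ?thesis
      using Ea by (simp add: B_sub_def B_opr_def Pair Y)
  qed
qed

lemma B_sub_tr: "w \<in> B_sub \<Longrightarrow> B_tr c w \<in> B_sub"
  by (simp add: B_sub_def B_tr_def mult.left_commute[of _ "grp c"])

lemma B_sub_sc: "w \<in> B_sub \<Longrightarrow> B_sc c w \<in> B_sub"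
  by (simp add: B_sub_def B_sc_def mult.left_commute[of _ "B_const c"])

lemma B_sub_add: "v \<in> B_sub \<Longrightarrow> w \<in> B_sub \<Longrightarrow> v + w \<in> B_sub"
  by (simp add: B_sub_def distrib_left)

lemma B_sub_0: "0 \<in> B_sub"
  by (simp add: B_sub_def)

lemma B_sub_sum: "(\<And>i. i \<in> A \<Longrightarrow> f i \<in> B_sub) \<Longrightarrow> (\<Sum>i\<in>A. f i) \<in> B_sub"
  by (induction A rule: infinite_finite_induct) (auto simp: B_sub_0 intro: B_sub_add)

lemma B_sub_act:
  assumes "w \<in> B_sub"
  shows "B.act s w \<in> B_sub"
proof -
  have "B.word_op ws v \<in> B_sub" if "v \<in> B_sub" for ws v
    by (induction ws) (simp_all add: B.word_op_def that B_sub_opr)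
  then show ?thesis
    unfolding B.act_def B.rep_def by (intro B_sub_sum B_sub_sc) (simp add: assms B_sub_tr)
qed

text \<open>Modulo \<open>p\<close> the binomial coefficients of \<open>(g - 1)^(p - 1)\<close> are
  alternating signs, which cancel the signs of the expansion.\<close>

lemma sum_grp: "(\<Sum>c\<in>prime_field. grp c) = u ^ (2 * half)"
proof -
  let ?g = "grp 1 :: 'k \<Rightarrow>\<^sub>0 'k" and ?q = "2 * half"
  have "u ^ ?q = (\<Sum>i\<le>?q. of_nat (?q choose i) * (- 1) ^ i * ?g ^ (?q - i))"
    using binomial_ring[of "- 1" ?g ?q] by (simp add: u_def)
  also have "\<dots> = (\<Sum>i\<le>?q. ?g ^ (?q - i))"
  proof (rule sum.cong)
    fix i assume "i \<in> {..?q}"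
    then have "of_nat (?q choose i) = (- 1 :: 'k \<Rightarrow>\<^sub>0 'k) ^ i"
      using of_nat_choose_prime[OF prime_char[unfolded CHAR_eq] of_nat_CHAR_B[unfolded CHAR_eq]] by simp
    then show "of_nat (?q choose i) * (- 1) ^ i * ?g ^ (?q - i) = ?g ^ (?q - i)"
      by (simp flip: power_mult_distrib)
  qed simp
  also have "\<dots> = (\<Sum>i\<in>{..<CHAR('k)}. ?g ^ i)"
    unfolding CHAR_eq
    by (rule sum.reindex_bij_witness[where i = "\<lambda>i. ?q - i" and j = "\<lambda>i. ?q - i"]) auto
  also have "\<dots> = (\<Sum>c\<in>prime_field. grp c)"
    unfolding prime_field_eq[OF char_pos] by (simp add: sum.reindex[OF inj_on_of_nat_CHAR] grp_of_nat)
  finally show ?thesis by simp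
qed

lemma u_mult_sum_grp: "u * (\<Sum>c\<in>prime_field. grp c) = 0"
  using sum_prime_field_shift[OF char_pos prime_field_1, of grp]
  by (simp add: u_def algebra_simps sum_distrib_left grp_add)

text \<open>The coefficient at exponent \<open>0\<close> is \<open>1\<close>, contributed by the
  term \<open>c = 0\<close> alone.\<close>

lemma sum_grp_nonzero: "(\<Sum>c\<in>prime_field. grp c) \<noteq> (0 :: 'k \<Rightarrow>\<^sub>0 'k)"
proof
  assume "(\<Sum>c\<in>prime_field. grp c) = (0 :: 'k \<Rightarrow>\<^sub>0 'k)"
  then have "(\<Sum>c\<in>prime_field. Poly_Mapping.lookup (grp c) 0) = (0 :: 'k)"
    by (simp flip: lookup_sum)
  then show False
    by (simp add: grp_def lookup_single when_def finite_prime_field[OF char_pos])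
qed

lemma group_sum_kills_B_sub:
  assumes "w \<in> B_sub"
  shows "B.act group_sum w = 0"
proof -
  have w: "u ^ half * fst w = 0" "u ^ Suc half * snd w = 0"
    using assms by (simp_all add: B_sub_def)
  \<comment> \<open>The exponent \<open>2 * half\<close> reaches \<open>half + 1\<close> because
    \<open>half\<close> is positive.\<close>
  have "u ^ (2 * half) = u ^ (half - 1) * u ^ Suc half"
    using half_pos by (simp only: power_add[symmetric]) (simp add: mult_2)
  then have "u ^ (2 * half) * snd w = 0"
    by (simp only: mult.assoc w mult_zero_right)
  moreover have "u ^ (2 * half) * fst w = 0"
    by (simp only: mult_2 power_add mult.assoc w mult_zero_right)
  ultimately have "u ^ (2 * half) * fst w = 0" "u ^ (2 * half) * snd w = 0"
    by simp_all
  then show ?thesis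
    by (simp add: B.act_group_sum prod_eq_iff fst_sum snd_sum B_tr_def sum_distrib_right[symmetric] sum_grp)
qed

lemma group_sum_act: "B.act group_sum (1, 0) = ((\<Sum>c\<in>prime_field. grp c), 0)"
  by (simp add: B.act_group_sum prod_eq_iff fst_sum snd_sum B_tr_def)

lemma group_sum_in_B_sub: "((\<Sum>c\<in>prime_field. grp c), 0) \<in> B_sub"
proof -
  have "u ^ half * (\<Sum>c\<in>prime_field. grp c) = u ^ (half - 1) * (u * (\<Sum>c\<in>prime_field. grp c))"
    using half_pos by (cases half) (simp_all add: mult.assoc mult.left_commute)
  then show ?thesis
    by (simp add: B_sub_def u_mult_sum_grp)
qed

end


section \<open>The global dimension of \<open>H\<^sub>\<lambda>\<close>\<close>

context H_param
begin

section \<open>Passage to the quotient ring\<close>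

abbreviation coset :: "('k ^ 2 ^ 2 \<Rightarrow> 'k free_alg) \<Rightarrow> ('k ^ 2 ^ 2 \<Rightarrow> 'k free_alg) set"
  where "coset s \<equiv> rel_ideal +>\<^bsub>smash_alg\<^esub> s"

lemma ring_H_alg: "ring (H_alg lam)"
  by (simp add: H_alg_eq J.quotient_is_ring)

lemma carrier_H_alg: "carrier (H_alg lam) = coset ` carrier smash_alg"
  by (auto simp: H_alg_eq FactRing_def A_RCOSETS_def')

lemma coset_eq_iff:
  "a \<in> carrier smash_alg \<Longrightarrow> b \<in> carrier smash_alg \<Longrightarrow> coset a = coset b \<longleftrightarrow> a - b \<in> rel_ideal"
  using S.quotient_eq_iff_same_a_r_cos[OF J.ideal_axioms, of a b] by (simp only: smash_a_minus)

lemma coset_mult: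
  "a \<in> carrier smash_alg \<Longrightarrow> b \<in> carrier smash_alg \<Longrightarrow>
    coset a \<otimes>\<^bsub>H_alg lam\<^esub> coset b = coset (a \<otimes>\<^bsub>smash_alg\<^esub> b)"
  using ring_hom_mult[OF J.rcos_ring_hom] by (simp add: H_alg_eq)

lemma coset_add:
  "a \<in> carrier smash_alg \<Longrightarrow> b \<in> carrier smash_alg \<Longrightarrow>
    coset a \<oplus>\<^bsub>H_alg lam\<^esub> coset b = coset (a + b)"
  using ring_hom_add[OF J.rcos_ring_hom] by (simp add: H_alg_eq flip: smash_alg_simps(4))

lemma coset_zero_iff:
  assumes "a \<in> carrier smash_alg"
  shows "coset a = \<zero>\<^bsub>H_alg lam\<^esub> \<longleftrightarrow> a \<in> rel_ideal"
proof -
  have "\<zero>\<^bsub>H_alg lam\<^esub> = coset \<zero>\<^bsub>smash_alg\<^esub>"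
    using S.a_coset_add_zero[OF J.a_subset] by (simp add: H_alg_eq FactRing_def)
  then show ?thesis
    using coset_eq_iff[OF assms S.zero_closed] by (simp only: smash_alg_simps(2) diff_0_right)
qed

lemma exact_H_alg_diff:
  assumes "r \<in> carrier (H_alg lam)"
    and "coset (group_elem 1 - \<one>\<^bsub>smash_alg\<^esub>) \<otimes>\<^bsub>H_alg lam\<^esub> r = \<zero>\<^bsub>H_alg lam\<^esub>"
  shows "\<exists>s\<in>carrier (H_alg lam). r = coset group_sum \<otimes>\<^bsub>H_alg lam\<^esub> s"
proof -
  obtain t where t: "t \<in> carrier smash_alg" "r = coset t"
    using assms(1) by (auto simp: carrier_H_alg)
  have "(group_elem 1 - \<one>\<^bsub>smash_alg\<^esub>) \<otimes>\<^bsub>smash_alg\<^esub> t \<in> rel_ideal"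
    using assms(2) t by (simp only: coset_mult coset_zero_iff group_diff_closed S.m_closed)
  then obtain w where w: "w \<in> carrier smash_alg" "t - group_sum \<otimes>\<^bsub>smash_alg\<^esub> w \<in> rel_ideal"
    by (rule rel_exact_diff[OF t(1)])
  then have "r = coset group_sum \<otimes>\<^bsub>H_alg lam\<^esub> coset w"
    using t by (simp only: coset_mult coset_eq_iff group_sum_closed S.m_closed)
  then show ?thesis
    using w(1) by (auto simp: carrier_H_alg)
qed

lemma exact_H_alg_sum:
  assumes "r \<in> carrier (H_alg lam)"
    and "coset group_sum \<otimes>\<^bsub>H_alg lam\<^esub> r = \<zero>\<^bsub>H_alg lam\<^esub>"
  shows "\<exists>s\<in>carrier (H_alg lam). r = coset (group_elem 1 - \<one>\<^bsub>smash_alg\<^esub>) \<otimes>\<^bsub>H_alg lam\<^esub> s"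
proof -
  obtain t where t: "t \<in> carrier smash_alg" "r = coset t"
    using assms(1) by (auto simp: carrier_H_alg)
  have "group_sum \<otimes>\<^bsub>smash_alg\<^esub> t \<in> rel_ideal"
    using assms(2) t by (simp only: coset_mult coset_zero_iff group_sum_closed S.m_closed)
  then obtain w where w: "w \<in> carrier smash_alg"
      "t - (group_elem 1 - \<one>\<^bsub>smash_alg\<^esub>) \<otimes>\<^bsub>smash_alg\<^esub> w \<in> rel_ideal"
    by (rule rel_exact_sum[OF t(1)])
  then have "r = coset (group_elem 1 - \<one>\<^bsub>smash_alg\<^esub>) \<otimes>\<^bsub>H_alg lam\<^esub> coset w"
    using t by (simp only: coset_mult coset_eq_iff group_diff_closed S.m_closed)
  then show ?thesis
    using w(1) by (auto simp: carrier_H_alg)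
qed

text \<open>The norm element absorbs group elements on either side. The two forms give the vanishing
  of its two products with \<open>g - 1\<close>.\<close>

lemma reg_tr_group_sum:
  fixes a :: 'k
  assumes "a \<in> prime_field"
  shows "reg_tr a group_sum = group_sum" "(\<Sum>c\<in>prime_field. reg_tr c (reg_tr a s)) = (\<Sum>c\<in>prime_field. reg_tr c s)"
proof -
  show *: "(\<Sum>c\<in>prime_field. reg_tr c (reg_tr a s)) = (\<Sum>c\<in>prime_field. reg_tr c s)" for s
    using sum_prime_field_shift[OF char_pos assms, of "\<lambda>c. reg_tr c s"] by (simp only: reg.tr_plus)
  have gs: "group_sum = (\<Sum>c\<in>(prime_field :: 'k set). reg_tr c \<one>\<^bsub>smash_alg\<^esub>)"
    by (rule act_regular_one[OF char_pos group_sum_closed, unfolded reg.act_group_sum, symmetric])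
  have "reg_tr a group_sum = (\<Sum>c\<in>prime_field. reg_tr c (reg_tr a \<one>\<^bsub>smash_alg\<^esub>))"
    unfolding gs reg.tr_sum by (simp only: reg.tr_plus[symmetric] add.commute)
  then show "reg_tr a group_sum = group_sum"
    by (simp only: * gs)
qed

lemma group_diff_mult_sum:
  "(group_elem 1 - \<one>\<^bsub>smash_alg\<^esub>) \<otimes>\<^bsub>smash_alg\<^esub> group_sum = (0 :: 'k ^ 2 ^ 2 \<Rightarrow> 'k free_alg)"
  by (simp only: act_regular[OF char_pos group_sum_closed, symmetric] reg.act_group_diff
      reg_tr_group_sum prime_field_1 diff_self)

lemma group_sum_mult_diff:
  "group_sum \<otimes>\<^bsub>smash_alg\<^esub> (group_elem 1 - \<one>\<^bsub>smash_alg\<^esub>) = (0 :: 'k ^ 2 ^ 2 \<Rightarrow> 'k free_alg)"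
proof -
  have d: "group_elem 1 - \<one>\<^bsub>smash_alg\<^esub> =
      (reg_tr 1 \<one>\<^bsub>smash_alg\<^esub> - \<one>\<^bsub>smash_alg\<^esub> :: 'k ^ 2 ^ 2 \<Rightarrow> 'k free_alg)"
    by (rule act_regular_one[OF char_pos group_diff_closed, unfolded reg.act_group_diff, symmetric])
  have "group_sum \<otimes>\<^bsub>smash_alg\<^esub> (group_elem 1 - \<one>\<^bsub>smash_alg\<^esub>) =
      (\<Sum>c\<in>(prime_field :: 'k set). reg_tr c (group_elem 1 - \<one>\<^bsub>smash_alg\<^esub>))"
    by (simp only: act_regular[OF char_pos group_diff_closed, symmetric] reg.act_group_sum)
  also have "\<dots> = 0"
    unfolding d by (simp only: reg.tr_diff sum_subtractf reg_tr_group_sum prime_field_1 diff_self)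
  finally show ?thesis .
qed

end

context H_param_t0
begin

lemma left_global_dimension_H_alg: "left_global_dimension TYPE('u) (H_alg lam) = \<infinity>"
proof -
  define e where "e = (1 :: 'k \<Rightarrow>\<^sub>0 'k, 0 :: 'k \<Rightarrow>\<^sub>0 'k)"
  \<comment> \<open>The elements that send \<open>e\<close> into \<open>B_sub\<close>; they form a
    left ideal because \<open>B_sub\<close> is stable under the action.\<close>
  define L where "L = coset ` {s \<in> carrier smash_alg. B.act s e \<in> B_sub}"
  let ?u = "coset (group_elem 1 - \<one>\<^bsub>smash_alg\<^esub>)" and ?N = "coset group_sum"
  have zero: "\<zero>\<^bsub>H_alg lam\<^esub> = coset 0"
    using coset_zero_iff[OF S.zero_closed] rel_ideal_0 by (simp add: smash_alg_simps(2))
  show ?thesis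
  proof (rule left_global_dimension_infinite_left_ideal[where L = L and a = ?u and b = ?N and x = ?N])
    show "ring (H_alg lam)" by (rule ring_H_alg)
    show "L \<subseteq> carrier (H_alg lam)" by (auto simp: L_def carrier_H_alg)
    show "\<zero>\<^bsub>H_alg lam\<^esub> \<in> L"
      unfolding zero L_def using S.zero_closed B_sub_0
      by (intro imageI CollectI conjI) (simp_all only: smash_alg_simps(2) B.act_0)
    show "x \<oplus>\<^bsub>H_alg lam\<^esub> y \<in> L" if "x \<in> L" "y \<in> L" for x y
      using that S.a_closed unfolding L_def
      by (auto simp: coset_add B.act_plus B_sub_add smash_alg_simps(4) intro!: imageI)
    show "a \<otimes>\<^bsub>H_alg lam\<^esub> x \<in> L" if "a \<in> carrier (H_alg lam)" "x \<in> L" for a x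
      using that unfolding L_def
      by (auto simp: carrier_H_alg coset_mult B.act_mult B_sub_act intro!: imageI)
    show "?u \<in> carrier (H_alg lam)" "?N \<in> carrier (H_alg lam)"
      unfolding carrier_H_alg using group_diff_closed group_sum_closed by blast+
    \<comment> \<open>The second equation answers two premises, since the witness is \<open>?N\<close> itself.\<close>
    show "?N \<otimes>\<^bsub>H_alg lam\<^esub> ?u = \<zero>\<^bsub>H_alg lam\<^esub>" "?u \<otimes>\<^bsub>H_alg lam\<^esub> ?N = \<zero>\<^bsub>H_alg lam\<^esub>"
      "?u \<otimes>\<^bsub>H_alg lam\<^esub> ?N = \<zero>\<^bsub>H_alg lam\<^esub>"
      by (simp_all only: coset_mult group_diff_closed group_sum_closed group_diff_mult_sum
          group_sum_mult_diff zero)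
    show "?N \<in> L"
      unfolding L_def e_def using group_sum_closed group_sum_in_B_sub
      by (intro imageI CollectI conjI) (simp_all only: group_sum_act)
    show "?N \<noteq> ?N \<otimes>\<^bsub>H_alg lam\<^esub> y" if "y \<in> L" for y
    proof
      \<comment> \<open>Applied to \<open>e\<close>, the equation gives
        \<open>N e = N (s e) = 0\<close>, since \<open>s e\<close> lies in \<open>B_sub\<close>; but
        the first entry of \<open>N e\<close> is the nonzero sum over the group.\<close>
      assume *: "?N = ?N \<otimes>\<^bsub>H_alg lam\<^esub> y"
      obtain s where s: "s \<in> carrier smash_alg" "B.act s e \<in> B_sub" "y = coset s"
        using \<open>y \<in> L\<close> by (auto simp: L_def)
      have "group_sum - group_sum \<otimes>\<^bsub>smash_alg\<^esub> s \<in> rel_ideal"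
        using * s(1) by (simp only: s(3) coset_mult coset_eq_iff group_sum_closed S.m_closed)
      then have "B.act (group_sum - group_sum \<otimes>\<^bsub>smash_alg\<^esub> s) e = 0"
        by (rule B.act_rel_ideal)
      then have "B.act group_sum e = B.act group_sum (B.act s e)"
        by (simp only: B.act_minus B.act_mult right_minus_eq)
      also have "\<dots> = 0"
        by (rule group_sum_kills_B_sub[OF s(2)])
      finally show False
        using sum_grp_nonzero by (simp add: e_def group_sum_act prod_eq_iff)
    qed
  qed (use exact_H_alg_diff exact_H_alg_sum in blast)+
qed

end

theorem corollary5p23:
  fixes p :: nat and lam :: "'k :: alg_closed_field ^ 2 ^ 2 \<Rightarrow> 'k"
  assumes "prime p" and "odd p" and "CHAR('k) = p"
    and "lam \<in> carrier (group_algebra G_grp)"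
    and "lam \<one>\<^bsub>G_grp\<^esub> = 0"
  shows "left_global_dimension TYPE('u) (H_alg lam) = \<infinity>"
proof -
  interpret H_param_t0 lam
    by unfold_locales (use assms prime_gt_0_nat in \<open>auto simp: one_G_grp\<close>)
  show ?thesis by (rule left_global_dimension_H_alg)
qed

end
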